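(* The following problem is undecidable: given a TPTL-formula $\varphi$, decide whether there exists an MTL-formula equivalent to $\varphi$ (i.e., satisfied by exactly the same data words).
   Context: Let $\mathcal{P}$ be a finite set of propositional variables. A data word is an infinite sequence $w=(P_0,d_0)(P_1,d_1)\dots$ with $P_i\subseteq\mathcal{P}$ and $d_i\in\mathbb{N}$. Intervals $I$ are (half-)open or (half-)closed intervals of integers with endpoints in $\mathbb{Z}\cup\{\pm\infty\}$. MTL formulas: $\varphi::=p\mid\neg\varphi\mid\varphi_1\wedge\varphi_2\mid\varphi_1\mathsf{U}_I\varphi_2$, with $(w,i)\models\varphi_1\mathsf{U}_I\varphi_2$ iff there is $j>i$ with $(w,j)\models\varphi_2$, $d_j-d_i\in I$, and $(w,k)\models\varphi_1$ for all $i<k<j$; $(w,i)\models p$ iff $p\in P_i$; $w\models\varphi$ iff $(w,0)\models\varphi$. TPTL formulas: $\varphi::=p\mid x\in I\mid\neg\varphi\mid\varphi_1\wedge\varphi_2\mid\varphi_1\mathsf{U}\varphi_2\mid x.\varphi$ with register variables $x$; with a valuation $\nu$ of registers in $\mathbb{N}$: $(w,i,\nu)\models x\in I$ iff $d_i-\nu(x)\in I$; $(w,i,\nu)\models x.\varphi$ iff $(w,i,\nu[x\mapsto d_i])\models\varphi$; $(w,i,\nu)\models\varphi_1\mathsf{U}\varphi_2$ iff there is $j>i$ with $(w,j,\nu)\models\varphi_2$ and $(w,k,\nu)\models\varphi_1$ for all $i<k<j$. $w\models\varphi$ iff $(w,0,\nu_0)\models\varphi$ with $\nu_0$ mapping every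 register to $d_0$. *)

theory Defs
  imports Main "HOL-Library.Extended" "HOL-Library.Nat_Bijection" "HOL-Library.Countable"
begin

section \<open>Data words and intervals\<close>

text \<open>The finite set of propositional variables is the universe of a type \<open>'p :: finite\<close>.\<close>

type_synonym 'p data_word = "nat \<Rightarrow> 'p set \<times> nat"

abbreviation props :: "'p data_word \<Rightarrow> nat \<Rightarrow> 'p set" where
  "props w i \<equiv> fst (w i)"

abbreviation dval :: "'p data_word \<Rightarrow> nat \<Rightarrow> nat" where
  "dval w i \<equiv> snd (w i)"

text \<open>In the constructor names, O and C say, for the left and the right endpoint, whether it is open or closed.\<close>

datatype interval =
    IOO "int extended" "int extended"
  | IOC "int extended" "int extended"
  | ICO "int extended" "int extended"
  | ICC "int extended" "int extended"

fun ints_of :: "interval \<Rightarrow> int set" where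
  "ints_of (IOO a b) = {z. a < Fin z \<and> Fin z < b}"
| "ints_of (IOC a b) = {z. a < Fin z \<and> Fin z \<le> b}"
| "ints_of (ICO a b) = {z. a \<le> Fin z \<and> Fin z < b}"
| "ints_of (ICC a b) = {z. a \<le> Fin z \<and> Fin z \<le> b}"

section \<open>MTL\<close>

datatype 'p mtl =
    MProp 'p
  | MNot "'p mtl"
  | MAnd "'p mtl" "'p mtl"
  | MUntil "'p mtl" interval "'p mtl"

fun mtl_sat :: "'p data_word \<Rightarrow> nat \<Rightarrow> 'p mtl \<Rightarrow> bool" where
  "mtl_sat w i (MProp p) \<longleftrightarrow> p \<in> props w i"
| "mtl_sat w i (MNot \<phi>) \<longleftrightarrow> \<not> mtl_sat w i \<phi>"
| "mtl_sat w i (MAnd \<phi> \<psi>) \<longleftrightarrow> mtl_sat w i \<phi> \<and> mtl_sat w i \<psi>"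
| "mtl_sat w i (MUntil \<phi> I \<psi>) \<longleftrightarrow>
     (\<exists>j>i. mtl_sat w j \<psi> \<and> int (dval w j) - int (dval w i) \<in> ints_of I \<and>
            (\<forall>k. i < k \<and> k < j \<longrightarrow> mtl_sat w k \<phi>))"

definition mtl_models :: "'p data_word \<Rightarrow> 'p mtl \<Rightarrow> bool" where
  "mtl_models w \<phi> \<longleftrightarrow> mtl_sat w 0 \<phi>"

section \<open>TPTL\<close>

type_synonym register = nat

datatype 'p tptl =
    TProp 'p
  | TIn register interval
  | TNot "'p tptl"
  | TAnd "'p tptl" "'p tptl"
  | TUntil "'p tptl" "'p tptl"
  | TFreeze register "'p tptl"

fun tptl_sat :: "'p data_word \<Rightarrow> nat \<Rightarrow> (register \<Rightarrow> nat) \<Rightarrow> 'p tptl \<Rightarrow> bool" where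
  "tptl_sat w i \<nu> (TProp p) \<longleftrightarrow> p \<in> props w i"
| "tptl_sat w i \<nu> (TIn x I) \<longleftrightarrow> int (dval w i) - int (\<nu> x) \<in> ints_of I"
| "tptl_sat w i \<nu> (TNot \<phi>) \<longleftrightarrow> \<not> tptl_sat w i \<nu> \<phi>"
| "tptl_sat w i \<nu> (TAnd \<phi> \<psi>) \<longleftrightarrow> tptl_sat w i \<nu> \<phi> \<and> tptl_sat w i \<nu> \<psi>"
| "tptl_sat w i \<nu> (TUntil \<phi> \<psi>) \<longleftrightarrow>
     (\<exists>j>i. tptl_sat w j \<nu> \<psi> \<and> (\<forall>k. i < k \<and> k < j \<longrightarrow> tptl_sat w k \<nu> \<phi>))"
| "tptl_sat w i \<nu> (TFreeze x \<phi>) \<longleftrightarrow> tptl_sat w i (\<nu>(x := dval w i)) \<phi>"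

definition tptl_models :: "'p data_word \<Rightarrow> 'p tptl \<Rightarrow> bool" where
  "tptl_models w \<phi> \<longleftrightarrow> tptl_sat w 0 (\<lambda>_. dval w 0) \<phi>"

definition tptl_mtl_equivalent :: "'p tptl \<Rightarrow> 'p mtl \<Rightarrow> bool" where
  "tptl_mtl_equivalent \<phi> \<psi> \<longleftrightarrow> (\<forall>w. tptl_models w \<phi> \<longleftrightarrow> mtl_models w \<psi>)"

section \<open>Partial recursive functions\<close>

datatype recf =
    Zero
  | Succ
  | Proj nat
  | Comp recf "recf list"
  | PrimRec recf recf
  | Mu recf

text \<open>\<open>rec_eval f xs y\<close> means that the function denoted by \<open>f\<close> is defined
  on the arguments \<open>xs\<close> and has the value \<open>y\<close> there.\<close>

inductive rec_eval :: "recf \<Rightarrow> nat list \<Rightarrow> nat \<Rightarrow> bool" where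
  Zero: "rec_eval Zero xs 0"
| Succ: "rec_eval Succ [x] (Suc x)"
| Proj: "i < length xs \<Longrightarrow> rec_eval (Proj i) xs (xs ! i)"
| Comp: "list_all2 (\<lambda>g y. rec_eval g xs y) gs ys \<Longrightarrow> rec_eval f ys z \<Longrightarrow>
    rec_eval (Comp f gs) xs z"
| PrimRec_0: "rec_eval f xs y \<Longrightarrow> rec_eval (PrimRec f g) (0 # xs) y"
| PrimRec_Suc: "rec_eval (PrimRec f g) (n # xs) y \<Longrightarrow> rec_eval g (n # y # xs) z \<Longrightarrow>
    rec_eval (PrimRec f g) (Suc n # xs) z"
| Mu: "rec_eval f (n # xs) 0 \<Longrightarrow> (\<forall>m<n. \<exists>y. rec_eval f (m # xs) y \<and> y \<noteq> 0) \<Longrightarrow>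
    rec_eval (Mu f) xs n"

lemma rec_eval_deterministic: "rec_eval f xs y \<Longrightarrow> rec_eval f xs z \<Longrightarrow> y = z"
proof (induction arbitrary: z rule: rec_eval.induct)
  case (Comp xs gs ys f u)
  from Comp.prems obtain ys' where ys': "list_all2 (\<lambda>g y. rec_eval g xs y) gs ys'" "rec_eval f ys' z"
    by cases auto
  have "ys = ys'"
  proof (rule nth_equalityI)
    show "length ys = length ys'"
      using Comp.IH(1) ys'(1) by (simp add: list_all2_conv_all_nth)
  next
    fix i assume "i < length ys"
    then show "ys ! i = ys' ! i"
      using Comp.IH(1) ys'(1) by (simp add: list_all2_conv_all_nth)
  qed
  with Comp.IH(2) ys'(2) show ?case by simp
next
  case (PrimRec_0 f xs y g)
  from PrimRec_0.prems show ?case by cases (auto intro: PrimRec_0.IH)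
next
  case (PrimRec_Suc f g n xs y u)
  from PrimRec_Suc.prems obtain y' where "rec_eval (PrimRec f g) (n # xs) y'" "rec_eval g (n # y' # xs) z"
    by cases auto
  then show ?case using PrimRec_Suc.IH by blast
next
  case (Mu f n xs)
  from Mu.prems obtain "rec_eval f (z # xs) 0" "\<forall>m<z. \<exists>y. rec_eval f (m # xs) y \<and> y \<noteq> 0"
    by cases auto
  then show ?case using Mu.IH by (metis linorder_neqE_nat)
qed (auto elim: rec_eval.cases)

text \<open>Nothing is required of the decision procedure on numbers that are not codes, so
  undecidability never stems from the difficulty of recognising codes.\<close>

definition decidable :: "('a \<Rightarrow> nat) \<Rightarrow> ('a \<Rightarrow> bool) \<Rightarrow> bool" where
  "decidable code Q \<longleftrightarrow> (\<exists>f. \<forall>a. rec_eval f [code a] (if Q a then 1 else 0))"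

section \<open>Goedel numbering of TPTL formulas\<close>

fun endpoint_code :: "int extended \<Rightarrow> nat" where
  "endpoint_code Minf = 0"
| "endpoint_code Pinf = 1"
| "endpoint_code (Fin z) = 2 + int_encode z"

fun interval_code :: "interval \<Rightarrow> nat" where
  "interval_code (IOO a b) = prod_encode (0, prod_encode (endpoint_code a, endpoint_code b))"
| "interval_code (IOC a b) = prod_encode (1, prod_encode (endpoint_code a, endpoint_code b))"
| "interval_code (ICO a b) = prod_encode (2, prod_encode (endpoint_code a, endpoint_code b))"
| "interval_code (ICC a b) = prod_encode (3, prod_encode (endpoint_code a, endpoint_code b))"

text \<open>\<open>to_nat\<close> is an unspecified injection, but on a finite type any two numberings are
  computably intertranslatable, so the choice does not affect decidability.\<close>

fun tptl_code :: "'p::finite tptl \<Rightarrow> nat" where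
  "tptl_code (TProp p) = prod_encode (0, to_nat p)"
| "tptl_code (TIn x I) = prod_encode (1, prod_encode (x, interval_code I))"
| "tptl_code (TNot \<phi>) = prod_encode (2, tptl_code \<phi>)"
| "tptl_code (TAnd \<phi> \<psi>) = prod_encode (3, prod_encode (tptl_code \<phi>, tptl_code \<psi>))"
| "tptl_code (TUntil \<phi> \<psi>) = prod_encode (4, prod_encode (tptl_code \<phi>, tptl_code \<psi>))"
| "tptl_code (TFreeze x \<phi>) = prod_encode (5, prod_encode (x, tptl_code \<phi>))"

lemma endpoint_code_eq_iff: "endpoint_code a = endpoint_code b \<longleftrightarrow> a = b"
  by (cases a; cases b) (auto simp: int_encode_eq)

lemma interval_code_eq_iff: "interval_code I = interval_code J \<longleftrightarrow> I = J"
  by (cases I; cases J) (auto simp: endpoint_code_eq_iff prod_encode_eq)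

lemma tptl_code_eq_iff: "tptl_code \<phi> = tptl_code \<psi> \<longleftrightarrow> \<phi> = \<psi>"
proof (induction \<phi> arbitrary: \<psi>)
  case (TProp p) show ?case by (cases \<psi>) (auto simp: prod_encode_eq)
next
  case (TIn x I) show ?case by (cases \<psi>) (auto simp: interval_code_eq_iff prod_encode_eq)
next
  case (TNot \<phi>) then show ?case by (cases \<psi>) (auto simp: prod_encode_eq)
next
  case (TAnd \<phi>1 \<phi>2) then show ?case by (cases \<psi>) (auto simp: prod_encode_eq)
next
  case (TUntil \<phi>1 \<phi>2) then show ?case by (cases \<psi>) (auto simp: prod_encode_eq)
next
  case (TFreeze x \<phi>) then show ?case by (cases \<psi>) (auto simp: prod_encode_eq)
qed

end

theory Submission
  imports Defs
begin

text \<open>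
  Every partial recursive \<open>h\<close> yields a TPTL formula \<open>A h\<close> whose models start with a data value
  \<open>b\<close>, kept in register 0 as the origin, then \<open>b + n\<close>, followed by finitely many
  blocks that list the nodes of a derivation of \<open>h(n) = 1\<close>, each node justified by later ones. A last
  conjunct constrains one value behind the final block relative to \<open>b\<close>; MTL cannot express it, since
  behind the blocks the values may grow so fast that all positions there look alike. Hence the
  conjunction of \<open>A h\<close> with a formula fixing \<open>n\<close> is MTL-definable iff \<open>h(n) \<noteq> 1\<close>.
  From a decision procedure \<open>f\<close> we get the function \<open>h\<close> that maps the code of \<open>\<phi>\<close> to the answer of
  \<open>f\<close> on the conjunction of \<open>\<phi>\<close> with the formula fixing the input to the code of \<open>\<phi>\<close>. Feeding
  \<open>h\<close> the code of \<open>A h\<close> is contradictory.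
\<close>

section \<open>Recursive functions for pairing\<close>

lemma rec_eval_Comp1:
  "rec_eval g xs y \<Longrightarrow> rec_eval f [y] z \<Longrightarrow> rec_eval (Comp f [g]) xs z"
  by (rule rec_eval.Comp[where ys = "[y]"]) auto

lemma rec_eval_Comp2:
  "rec_eval g xs y \<Longrightarrow> rec_eval g' xs y' \<Longrightarrow> rec_eval f [y, y'] z \<Longrightarrow>
    rec_eval (Comp f [g, g']) xs z"
  by (rule rec_eval.Comp[where ys = "[y, y']"]) auto

lemma rec_eval_Proj: "i < length xs \<Longrightarrow> xs ! i = y \<Longrightarrow> rec_eval (Proj i) xs y"
  using rec_eval.Proj by blast

fun rconst :: "nat \<Rightarrow> recf" where
  "rconst 0 = Zero"
| "rconst (Suc k) = Comp Succ [rconst k]"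

lemma rec_eval_rconst: "rec_eval (rconst k) xs k"
  by (induction k) (auto intro: rec_eval_Comp1 rec_eval.Zero rec_eval.Succ)

definition radd :: recf where
  "radd = PrimRec (Proj 0) (Comp Succ [Proj 1])"

lemma rec_eval_radd: "rec_eval radd [m, n] (m + n)"
proof (induction m)
  case 0
  then show ?case
    unfolding radd_def by (auto intro!: rec_eval.PrimRec_0 rec_eval_Proj)
next
  case (Suc m)
  then show ?case
    unfolding radd_def
    by (auto intro!: rec_eval.PrimRec_Suc[where y = "m + n"] rec_eval_Comp1[where y = "m + n"]
        rec_eval_Proj rec_eval.Succ)
qed

definition rtriangle :: recf where
  "rtriangle = PrimRec Zero (Comp radd [Comp Succ [Proj 0], Proj 1])"

lemma rec_eval_rtriangle: "rec_eval rtriangle [n] (triangle n)"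
proof (induction n)
  case 0
  then show ?case
    unfolding rtriangle_def by (auto intro!: rec_eval.PrimRec_0 rec_eval.Zero)
next
  case (Suc n)
  have "rec_eval (Comp radd [Comp Succ [Proj 0], Proj 1]) [n, triangle n] (Suc n + triangle n)"
    by (rule rec_eval_Comp2[OF rec_eval_Comp1[OF rec_eval_Proj rec_eval.Succ] rec_eval_Proj
        rec_eval_radd]) auto
  with Suc show ?case
    unfolding rtriangle_def triangle_Suc by (auto intro: rec_eval.PrimRec_Suc simp: add.commute)
qed

text \<open>Codes of formulas are nested Cantor pairs, so this lets the diagonal argument compute
  the code of a formula from the code of one of its parts.\<close>

definition rpair :: "recf \<Rightarrow> recf \<Rightarrow> recf" where
  "rpair f g = Comp radd [Comp rtriangle [Comp radd [f, g]], f]"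

lemma rec_eval_rpair:
  "rec_eval f xs m \<Longrightarrow> rec_eval g xs n \<Longrightarrow> rec_eval (rpair f g) xs (prod_encode (m, n))"
  unfolding rpair_def prod_encode_def
  by (auto intro!: rec_eval_Comp2 rec_eval_Comp1 intro: rec_eval_radd rec_eval_rtriangle)

section \<open>Horn clauses with successor constraints\<close>

text \<open>The offset \<open>k\<close> in \<open>Diff\<close> points forward, because a word can
  only compare a stored value with one at a later position. Constants, positivity, equality and
  successor are all that the clauses have to express.\<close>

datatype constr = Val nat interval | Diff nat nat interval

fun constr_holds :: "(nat \<Rightarrow> nat) \<Rightarrow> constr \<Rightarrow> bool" where
  "constr_holds v (Val l I) \<longleftrightarrow> int (v l) \<in> ints_of I"
| "constr_holds v (Diff l k I) \<longleftrightarrow> int (v (l + k)) - int (v l) \<in> ints_of I"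

text \<open>A clause consists of the predicate of its head, constraints, and body atoms, which are pairs of
  a predicate and a list of clause variables. The head has no argument list, because its arguments are
  always the variables \<open>0, 1, \<dots>\<close>.\<close>

type_synonym clause = "nat \<times> constr list \<times> (nat \<times> nat list) list"

text \<open>A fact carries a total valuation, auxiliary variables included. A body atom ties only
  the first \<open>length (snd a)\<close> variables of the supporting fact to \<open>v\<close>; its
  other variables stay existential.\<close>

inductive derives :: "clause list \<Rightarrow> nat \<Rightarrow> (nat \<Rightarrow> nat) \<Rightarrow> bool" for C where
  "(t, cs, body) \<in> set C \<Longrightarrow> \<forall>c\<in>set cs. constr_holds v c \<Longrightarrow>
   \<forall>a\<in>set body. \<exists>v'. derives C (fst a) v' \<and> (\<forall>k<length (snd a). v' k = v (snd a ! k)) \<Longrightarrow>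
   derives C t v"

definition derivable :: "clause list \<Rightarrow> nat \<Rightarrow> nat list \<Rightarrow> bool" where
  "derivable C t xs \<longleftrightarrow> (\<exists>v. derives C t v \<and> (\<forall>k<length xs. v k = xs ! k))"

lemma derivableI:
  assumes "(t, cs, body) \<in> set C"
    and "\<forall>c\<in>set cs. constr_holds (nth zs) c"
    and "\<forall>a\<in>set body. derivable C (fst a) (map (nth zs) (snd a))"
    and "zs = xs @ ys"
  shows "derivable C t xs"
proof -
  have "derives C t (nth zs)"
    using assms(1-3) by (intro derives.intros) (auto simp: derivable_def)
  then show ?thesis
    using assms(4) by (auto simp: derivable_def nth_append)
qed

section \<open>Derivations of recursive function values\<close>

instance recf :: countable
  by countable_datatype

text \<open>Predicates have to become data values. The arity belongs to the predicate because a
  program may be run on argument lists of different lengths. Any injection will do: the formula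
  built from the tags is fixed together with \<open>h\<close> and never computed from it.\<close>

definition eval_tag :: "recf \<Rightarrow> nat \<Rightarrow> nat" where
  "eval_tag f a = to_nat (False, f, a)"

definition below_tag :: "recf \<Rightarrow> nat \<Rightarrow> nat" where
  "below_tag f a = to_nat (True, f, a)"

lemma tag_simps [simp]:
  "eval_tag f a = eval_tag g b \<longleftrightarrow> f = g \<and> a = b"
  "below_tag f a = below_tag g b \<longleftrightarrow> f = g \<and> a = b"
  "eval_tag f a \<noteq> below_tag g b"
  "below_tag g b \<noteq> eval_tag f a"
  by (auto simp: eval_tag_def below_tag_def)

abbreviation point :: "int \<Rightarrow> interval" where
  "point k \<equiv> ICC (Fin k) (Fin k)"

abbreviation ray :: "int \<Rightarrow> interval" where
  "ray k \<equiv> ICO (Fin k) Pinf"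

lemma ints_of_point [simp]: "ints_of (point k) = {k}"
  by auto

lemma ints_of_ray [simp]: "ints_of (ray k) = {k..}"
  by auto

declare ints_of.simps [simp del]

text \<open>In a clause for \<open>eval_tag f a\<close> variable 0 is the value, variables \<open>1..a\<close> are the arguments, and
  later ones are auxiliary. In a clause for \<open>below_tag f a\<close> variable 0 is a number \<open>n\<close> such that
  \<open>f\<close> is positive on all first arguments below \<open>n\<close>.\<close>

fun own_clauses :: "recf \<Rightarrow> nat \<Rightarrow> clause list" where
  "own_clauses Zero a = [(eval_tag Zero a, [Val 0 (point 0)], [])]"
| "own_clauses Succ a = (if a = 1 then [(eval_tag Succ a, [Diff 0 1 (point (- 1))], [])] else [])"
| "own_clauses (Proj i) a =
     (if i < a then [(eval_tag (Proj i) a, [Diff 0 (Suc i) (point 0)], [])] else [])"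
| "own_clauses (Comp f gs) a =
     [(eval_tag (Comp f gs) a, [],
       (eval_tag f (length gs), 0 # [Suc a..<Suc a + length gs]) #
       map (\<lambda>j. (eval_tag (gs ! j) a, (Suc a + j) # [1..<Suc a])) [0..<length gs])]"
| "own_clauses (PrimRec f g) a =
     (if a = 0 then [] else
       [(eval_tag (PrimRec f g) a, [Val 1 (point 0)], [(eval_tag f (a - 1), 0 # [2..<Suc a])]),
        (eval_tag (PrimRec f g) a, [Diff 1 a (point (- 1))],
         [(eval_tag (PrimRec f g) a, (a + 2) # (a + 1) # [2..<Suc a]),
          (eval_tag g (Suc a), 0 # (a + 1) # (a + 2) # [2..<Suc a])])])"
| "own_clauses (Mu f) a =
     [(eval_tag (Mu f) a, [Val (Suc a) (point 0)],
       [(eval_tag f (Suc a), Suc a # 0 # [1..<Suc a]), (below_tag f a, 0 # [1..<Suc a])]),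
      (below_tag f a, [Val 0 (point 0)], []),
      (below_tag f a, [Diff 0 (Suc a) (point (- 1)), Val (a + 2) (ray 1)],
       [(eval_tag f (Suc a), (a + 2) # (a + 1) # [1..<Suc a]),
        (below_tag f a, (a + 1) # [1..<Suc a])])]"

fun clauses :: "recf \<Rightarrow> nat \<Rightarrow> clause list" where
  "clauses (Comp f gs) a =
     own_clauses (Comp f gs) a @ clauses f (length gs) @ concat (map (\<lambda>g. clauses g a) gs)"
| "clauses (PrimRec f g) a =
     own_clauses (PrimRec f g) a @ clauses f (a - 1) @ clauses g (Suc a)"
| "clauses (Mu f) a = own_clauses (Mu f) a @ clauses f (Suc a)"
| "clauses f a = own_clauses f a"

lemma clauses_own: "c \<in> set (clauses f a) \<Longrightarrow> \<exists>g b. c \<in> set (own_clauses g b)"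
  by (induction f a rule: clauses.induct) (auto simp del: own_clauses.simps)

section \<open>Completeness of the clauses\<close>

lemma map_nth_shift:
  assumes "n = length us" "m = length us + length vs"
  shows "map (nth (us @ vs @ ws)) [n..<m] = vs"
  using assms by (intro nth_equalityI) (auto simp: nth_append)

text \<open>Each evaluation rule is matched by one clause. The witness lists hold the value, the
  arguments and then the intermediate results that the rule hides. Assuming only an inclusion in
  \<open>C\<close> makes the induction hypotheses applicable to subprograms.\<close>

lemma derivable_if_rec_eval:
  assumes "rec_eval f xs y" "set (clauses f (length xs)) \<subseteq> set C"
  shows "derivable C (eval_tag f (length xs)) (y # xs)"
  using assms
proof (induction rule: rec_eval.induct)
  case (Zero xs)
  then show ?case
    by (intro derivableI[where zs = "0 # xs" and ys = "[]"]) auto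
next
  case (Succ x)
  then show ?case
    by (intro derivableI[where zs = "[Suc x, x]" and ys = "[]"]) auto
next
  case (Proj i xs)
  then show ?case
    by (intro derivableI[where zs = "xs ! i # xs" and ys = "[]"]) auto
next
  case (Comp xs gs ys f z)
  let ?a = "length xs"
  have len: "length gs = length ys"
    using Comp.IH(1) by (simp add: list_all2_conv_all_nth)
  have sub: "set (clauses f (length ys)) \<subseteq> set C"
    "\<And>g. g \<in> set gs \<Longrightarrow> set (clauses g ?a) \<subseteq> set C"
    using Comp.prems len by auto
  have args: "map (nth (z # xs @ ys)) [1..<Suc ?a] = xs"
    using map_nth_shift[of 1 "[z]" "Suc ?a" xs ys] by simp
  have aux: "map (nth (z # xs @ ys)) [Suc ?a..<Suc ?a + length ys] = ys"
    using map_nth_shift[of "Suc ?a" "z # xs" "Suc ?a + length ys" ys "[]"] by simp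
  show ?case
  proof (rule derivableI[where zs = "z # xs @ ys" and ys = ys])
    show "(eval_tag (Comp f gs) ?a, [],
       (eval_tag f (length gs), 0 # [Suc ?a..<Suc ?a + length gs]) #
       map (\<lambda>j. (eval_tag (gs ! j) ?a, (Suc ?a + j) # [1..<Suc ?a])) [0..<length gs]) \<in> set C"
      using Comp.prems by auto
    have "derivable C (eval_tag f (length ys)) (z # ys)"
      using Comp.IH(2) sub(1) by simp
    moreover have "derivable C (eval_tag (gs ! j) ?a) (ys ! j # xs)" if "j < length gs" for j
      using Comp.IH(1) sub(2) that by (simp add: list_all2_conv_all_nth)
    ultimately show "\<forall>a\<in>set ((eval_tag f (length gs), 0 # [Suc ?a..<Suc ?a + length gs]) #
       map (\<lambda>j. (eval_tag (gs ! j) ?a, (Suc ?a + j) # [1..<Suc ?a])) [0..<length gs]).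
         derivable C (fst a) (map (nth (z # xs @ ys)) (snd a))"
      using args aux len by (auto simp: nth_append simp del: upt_Suc)
  qed auto
next
  case (PrimRec_0 f xs y g)
  let ?zs = "y # 0 # xs"
  have args: "map (nth ?zs) [2..<Suc (Suc (length xs))] = xs"
    using map_nth_shift[of 2 "[y, 0]" "Suc (Suc (length xs))" xs "[]"] by simp
  show ?case
    by (rule derivableI[where zs = ?zs and ys = "[]" and cs = "[Val 1 (point 0)]"
          and body = "[(eval_tag f (length xs), 0 # [2..<Suc (Suc (length xs))])]"])
      (use PrimRec_0 args in \<open>auto simp del: upt_Suc\<close>)
next
  case (PrimRec_Suc f g n xs y z)
  let ?zs = "z # Suc n # xs @ [n, y]" and ?a = "Suc (length xs)"
  have args: "map (nth ?zs) [2..<Suc ?a] = xs"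
    using map_nth_shift[of 2 "[z, Suc n]" "Suc ?a" xs "[n, y]"] by simp
  show ?case
    by (rule derivableI[where zs = ?zs and ys = "[n, y]" and cs = "[Diff 1 ?a (point (- 1))]"
          and body = "[(eval_tag (PrimRec f g) ?a, (?a + 2) # (?a + 1) # [2..<Suc ?a]),
          (eval_tag g (Suc ?a), 0 # (?a + 1) # (?a + 2) # [2..<Suc ?a])]"])
      (use PrimRec_Suc args in \<open>auto simp: nth_append simp del: upt_Suc\<close>)
next
  case (Mu f n xs)
  let ?a = "length xs"
  have sub: "set (clauses f (Suc ?a)) \<subseteq> set C" "set (own_clauses (Mu f) ?a) \<subseteq> set C"
    using Mu.prems by (auto simp del: own_clauses.simps)
  \<comment> \<open>The search found nonzero values at all arguments below \<open>n\<close>, so the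
    facts for \<open>below_tag\<close> can be built one by one up to \<open>n\<close>.\<close>
  have below: "derivable C (below_tag f ?a) (m # xs)" if "m \<le> n" for m
    using that
  proof (induction m)
    case 0
    show ?case
      by (rule derivableI[where zs = "0 # xs" and ys = "[]" and cs = "[Val 0 (point 0)]"
            and body = "[]"]) (use sub(2) in auto)
  next
    case (Suc m)
    then obtain y where y: "derivable C (eval_tag f (Suc ?a)) (y # m # xs)" "y \<noteq> 0"
      using Mu.IH sub(1) by (metis Suc_le_eq length_Cons)
    let ?zs = "Suc m # xs @ [m, y]"
    have args: "map (nth ?zs) [1..<Suc ?a] = xs"
      using map_nth_shift[of 1 "[Suc m]" "Suc ?a" xs "[m, y]"] by simp
    show ?case
      by (rule derivableI[where zs = ?zs and ys = "[m, y]"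
            and cs = "[Diff 0 (Suc ?a) (point (- 1)), Val (?a + 2) (ray 1)]"
            and body = "[(eval_tag f (Suc ?a), (?a + 2) # (?a + 1) # [1..<Suc ?a]),
             (below_tag f ?a, (?a + 1) # [1..<Suc ?a])]"])
        (use Suc y sub(2) args in \<open>auto simp: nth_append simp del: upt_Suc\<close>)
  qed
  let ?zs = "n # xs @ [0]"
  have args: "map (nth ?zs) [1..<Suc ?a] = xs"
    using map_nth_shift[of 1 "[n]" "Suc ?a" xs "[0]"] by simp
  show ?case
    by (rule derivableI[where zs = ?zs and ys = "[0]" and cs = "[Val (Suc ?a) (point 0)]"
          and body = "[(eval_tag f (Suc ?a), Suc ?a # 0 # [1..<Suc ?a]),
            (below_tag f ?a, 0 # [1..<Suc ?a])]"])
      (use Mu.IH sub below[of n] args in \<open>auto simp: nth_append simp del: upt_Suc\<close>)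
qed

section \<open>Soundness of the clauses\<close>

definition sound_fact :: "nat \<Rightarrow> (nat \<Rightarrow> nat) \<Rightarrow> bool" where
  "sound_fact t v \<longleftrightarrow>
     (\<forall>f a. t = eval_tag f a \<longrightarrow> rec_eval f (map v [1..<Suc a]) (v 0)) \<and>
     (\<forall>f a. t = below_tag f a \<longrightarrow>
        (\<forall>m<v 0. \<exists>y. rec_eval f (m # map v [1..<Suc a]) y \<and> y \<noteq> 0))"

lemma sound_fact_eval: "sound_fact (eval_tag f a) v \<longleftrightarrow> rec_eval f (map v [1..<Suc a]) (v 0)"
  by (auto simp: sound_fact_def)

lemma sound_fact_below:
  "sound_fact (below_tag f a) v \<longleftrightarrow>
     (\<forall>m<v 0. \<exists>y. rec_eval f (m # map v [1..<Suc a]) y \<and> y \<noteq> 0)"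
  by (auto simp: sound_fact_def)

lemma sound_fact_match_eval:
  assumes "sound_fact (eval_tag f a) v'" "\<forall>k<length ls. v' k = v (ls ! k)" "length ls = Suc a"
  shows "rec_eval f (map v (tl ls)) (v (hd ls))"
proof -
  have "map v' [1..<Suc a] = map v (tl ls)"
    using assms(2,3) by (intro nth_equalityI) (auto simp: nth_tl simp del: upt_Suc)
  moreover have "v' 0 = v (hd ls)"
    using assms(2,3) by (cases ls) auto
  ultimately show ?thesis
    using assms(1) by (simp add: sound_fact_eval del: upt_Suc)
qed

lemma sound_fact_match_below:
  assumes "sound_fact (below_tag f a) v'" "\<forall>k<length ls. v' k = v (ls ! k)" "length ls = Suc a"
  shows "\<forall>m<v (hd ls). \<exists>y. rec_eval f (m # map v (tl ls)) y \<and> y \<noteq> 0"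
proof -
  have "map v' [1..<Suc a] = map v (tl ls)"
    using assms(2,3) by (intro nth_equalityI) (auto simp: nth_tl simp del: upt_Suc)
  moreover have "v' 0 = v (hd ls)"
    using assms(2,3) by (cases ls) auto
  ultimately show ?thesis
    using assms(1) by (simp add: sound_fact_below del: upt_Suc)
qed

text \<open>Read from body to head, a clause for \<open>eval_tag\<close> is an introduction rule of
  \<open>rec_eval\<close>, and the clauses for \<open>below_tag\<close> start a range of positive
  values or extend it by one.\<close>

lemma own_clauses_sound:
  assumes "(t, cs, body) \<in> set (own_clauses g b)"
    and cs: "\<forall>c\<in>set cs. constr_holds v c"
    and body: "\<forall>a\<in>set body. \<exists>v'. sound_fact (fst a) v' \<and>
      (\<forall>k<length (snd a). v' k = v (snd a ! k))"
  shows "sound_fact t v"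
proof -
  have ev: "rec_eval f (map v (tl ls)) (v (hd ls))"
    if "(eval_tag f a, ls) \<in> set body" "length ls = Suc a" for f a ls
    using bspec[OF body that(1)] that(2) by (auto intro: sound_fact_match_eval)
  have bl: "\<forall>m<v (hd ls). \<exists>y. rec_eval f (m # map v (tl ls)) y \<and> y \<noteq> 0"
    if "(below_tag f a, ls) \<in> set body" "length ls = Suc a" for f a ls
    using bspec[OF body that(1)] sound_fact_match_below[OF _ _ that(2)] by auto
  show ?thesis
  proof (cases g)
    case Zero
    then show ?thesis
      using assms(1) cs by (auto simp: sound_fact_eval intro: rec_eval.Zero simp del: upt_Suc)
  next
    case Succ
    then have "t = eval_tag Succ 1" "v 0 = Suc (v 1)"
      using assms(1) cs by (auto split: if_splits)
    then show ?thesis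
      by (simp add: sound_fact_eval rec_eval.Succ)
  next
    case (Proj i)
    then have "t = eval_tag (Proj i) b" "v 0 = v (Suc i)" "i < b"
      using assms(1) cs by (auto split: if_splits)
    then show ?thesis
      by (auto simp: sound_fact_eval nth_append intro!: rec_eval_Proj simp del: upt_Suc)
  next
    case (Comp f gs)
    then have t: "t = eval_tag (Comp f gs) b"
      and b: "body = (eval_tag f (length gs), 0 # [Suc b..<Suc b + length gs]) #
       map (\<lambda>j. (eval_tag (gs ! j) b, (Suc b + j) # [1..<Suc b])) [0..<length gs]"
      using assms(1) by auto
    have "rec_eval (gs ! j) (map v [1..<Suc b]) (v (Suc b + j))" if "j < length gs" for j
      using ev[of "gs ! j" b "(Suc b + j) # [1..<Suc b]"] that
      unfolding b by (auto simp del: upt_Suc)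
    then have "list_all2 (\<lambda>g y. rec_eval g (map v [1..<Suc b]) y) gs
        (map v [Suc b..<Suc b + length gs])"
      by (auto simp: list_all2_conv_all_nth simp del: upt_Suc)
    moreover have "rec_eval f (map v [Suc b..<Suc b + length gs]) (v 0)"
      using ev[of f "length gs" "0 # [Suc b..<Suc b + length gs]"]
      unfolding b by (auto simp del: upt_Suc)
    ultimately show ?thesis
      unfolding t sound_fact_eval by (rule rec_eval.Comp)
  next
    case (PrimRec f g')
    then obtain b' where b': "b = Suc b'" and t: "t = eval_tag (PrimRec f g') b"
      using assms(1) by (cases b) auto
    have args: "map v [1..<Suc b] = v 1 # map v [2..<Suc b]"
      unfolding b' by (simp add: upt_conv_Cons numeral_2_eq_2 del: upt_Suc)
    consider (zero) "v 1 = 0" "body = [(eval_tag f (b - 1), 0 # [2..<Suc b])]"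
      | (suc) "v 1 = Suc (v (Suc b))"
        "body = [(eval_tag (PrimRec f g') b, (b + 2) # (b + 1) # [2..<Suc b]),
          (eval_tag g' (Suc b), 0 # (b + 1) # (b + 2) # [2..<Suc b])]"
      using assms(1) cs PrimRec b' by (auto simp del: upt_Suc)
    then show ?thesis
    proof cases
      case zero
      then show ?thesis
        using ev[of f b' "0 # [2..<Suc b]"] b'
        unfolding t sound_fact_eval args by (auto intro: rec_eval.PrimRec_0 simp del: upt_Suc)
    next
      case suc
      have "rec_eval (PrimRec f g') (v (Suc b) # map v [2..<Suc b]) (v (b + 2))"
        using ev[of "PrimRec f g'" b "(b + 2) # (b + 1) # [2..<Suc b]"] suc(2) b'
        by (auto simp del: upt_Suc)
      moreover have "rec_eval g' (v (Suc b) # v (b + 2) # map v [2..<Suc b]) (v 0)"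
        using ev[of g' "Suc b" "0 # (b + 1) # (b + 2) # [2..<Suc b]"] suc(2) b'
        by (auto simp del: upt_Suc)
      ultimately show ?thesis
        unfolding t sound_fact_eval args suc(1) by (rule rec_eval.PrimRec_Suc)
    qed
  next
    case (Mu f)
    consider (mu) "t = eval_tag (Mu f) b" "v (Suc b) = 0"
        "body = [(eval_tag f (Suc b), Suc b # 0 # [1..<Suc b]), (below_tag f b, 0 # [1..<Suc b])]"
      | (zero) "t = below_tag f b" "v 0 = 0"
      | (suc) "t = below_tag f b" "v 0 = Suc (v (Suc b))" "v (b + 2) \<noteq> 0"
        "body = [(eval_tag f (Suc b), (b + 2) # (b + 1) # [1..<Suc b]),
          (below_tag f b, (b + 1) # [1..<Suc b])]"
      using assms(1) cs Mu by (auto simp del: upt_Suc)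
    then show ?thesis
    proof cases
      case mu
      have "rec_eval f (v 0 # map v [1..<Suc b]) 0"
        using ev[of f "Suc b" "Suc b # 0 # [1..<Suc b]"] mu(2,3) by (auto simp del: upt_Suc)
      moreover have "\<forall>m<v 0. \<exists>y. rec_eval f (m # map v [1..<Suc b]) y \<and> y \<noteq> 0"
        using bl[of f b "0 # [1..<Suc b]"] mu(3) by (auto simp del: upt_Suc)
      ultimately show ?thesis
        unfolding mu(1) sound_fact_eval by (rule rec_eval.Mu)
    next
      case zero
      then show ?thesis by (simp add: sound_fact_below)
    next
      case suc
      have "rec_eval f (v (Suc b) # map v [1..<Suc b]) (v (b + 2))"
        using ev[of f "Suc b" "(b + 2) # (b + 1) # [1..<Suc b]"] suc(4) by (auto simp del: upt_Suc)
      moreover have "\<forall>m<v (Suc b). \<exists>y. rec_eval f (m # map v [1..<Suc b]) y \<and> y \<noteq> 0"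
        using bl[of f b "(b + 1) # [1..<Suc b]"] suc(4) by (auto simp del: upt_Suc)
      ultimately show ?thesis
        \<comment> \<open>A number below \<open>v 0\<close> is either below the predecessor
          \<open>v (Suc b)\<close> or equal to it, and there \<open>f\<close> has the nonzero value
          \<open>v (b + 2)\<close>.\<close>
        unfolding suc(1) sound_fact_below using suc(2,3) by (metis less_antisym)
    qed
  qed
qed

lemma derives_clauses_sound: "derives (clauses h a) t v \<Longrightarrow> sound_fact t v"
proof (induction rule: derives.induct)
  case (1 t cs body v)
  then obtain g b where "(t, cs, body) \<in> set (own_clauses g b)"
    using clauses_own by blast
  then show ?case
    by (rule own_clauses_sound) (use 1 in auto)
qed

section \<open>Derivations flattened into lists\<close>

fun justified :: "clause list \<Rightarrow> (nat \<times> (nat \<Rightarrow> nat)) list \<Rightarrow> bool" where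
  "justified C [] \<longleftrightarrow> True"
| "justified C ((t, v) # bs) \<longleftrightarrow> justified C bs \<and>
     (\<exists>cs body. (t, cs, body) \<in> set C \<and> (\<forall>c\<in>set cs. constr_holds v c) \<and>
       (\<forall>a\<in>set body. \<exists>v'. (fst a, v') \<in> set bs \<and> (\<forall>k<length (snd a). v' k = v (snd a ! k))))"

text \<open>Justification refers only to later entries, and appending only adds to these.\<close>

lemma justified_append: "justified C xs \<Longrightarrow> justified C ys \<Longrightarrow> justified C (xs @ ys)"
proof (induction xs)
  case (Cons b xs)
  obtain t v where b: "b = (t, v)" by fastforce
  show ?case
    using Cons unfolding b by simp (meson UnI1)
qed simp

lemma justified_concat: "\<forall>bs\<in>set bss. justified C bs \<Longrightarrow> justified C (concat bss)"
  by (induction bss) (auto intro: justified_append)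

lemma justified_nth:
  assumes "justified C bs" "q < length bs" "bs ! q = (t, v)"
  shows "\<exists>cs body. (t, cs, body) \<in> set C \<and> (\<forall>c\<in>set cs. constr_holds v c) \<and>
       (\<forall>a\<in>set body. \<exists>q' v'. q < q' \<and> q' < length bs \<and> bs ! q' = (fst a, v') \<and>
         (\<forall>k<length (snd a). v' k = v (snd a ! k)))"
  using assms
proof (induction bs arbitrary: q)
  case (Cons b bs)
  show ?case
  proof (cases q)
    case 0
    with Cons.prems have "justified C ((t, v) # bs)" by simp
    then obtain cs body where cb: "(t, cs, body) \<in> set C" "\<forall>c\<in>set cs. constr_holds v c"
      "\<forall>a\<in>set body. \<exists>v'. (fst a, v') \<in> set bs \<and> (\<forall>k<length (snd a). v' k = v (snd a ! k))"
      by auto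
    have "\<exists>q' v'. q < q' \<and> q' < length (b # bs) \<and> (b # bs) ! q' = (fst a, v') \<and>
         (\<forall>k<length (snd a). v' k = v (snd a ! k))" if a: "a \<in> set body" for a
    proof -
      obtain v' i where "i < length bs" "bs ! i = (fst a, v')"
        "\<forall>k<length (snd a). v' k = v (snd a ! k)"
        using cb(3) a by (metis in_set_conv_nth)
      then show ?thesis
        using 0 by (intro exI[of _ "Suc i"] exI[of _ v']) auto
    qed
    with cb(1,2) show ?thesis by blast
  next
    case (Suc q0)
    have "justified C bs" using Cons.prems(1) by (cases b) auto
    moreover have "q0 < length bs" "bs ! q0 = (t, v)" using Cons.prems Suc by auto
    ultimately obtain cs body where cb: "(t, cs, body) \<in> set C" "\<forall>c\<in>set cs. constr_holds v c"
      "\<forall>a\<in>set body. \<exists>q' v'. q0 < q' \<and> q' < length bs \<and> bs ! q' = (fst a, v') \<and>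
         (\<forall>k<length (snd a). v' k = v (snd a ! k))"
      using Cons.IH by blast
    have "\<exists>q' v'. q < q' \<and> q' < length (b # bs) \<and> (b # bs) ! q' = (fst a, v') \<and>
         (\<forall>k<length (snd a). v' k = v (snd a ! k))" if a: "a \<in> set body" for a
    proof -
      obtain v' i where "q0 < i" "i < length bs" "bs ! i = (fst a, v')"
        "\<forall>k<length (snd a). v' k = v (snd a ! k)"
        using cb(3) a by blast
      then show ?thesis
        using Suc by (intro exI[of _ "Suc i"] exI[of _ v']) auto
    qed
    with cb(1,2) show ?thesis by blast
  qed
qed simp

text \<open>A node is put in front of the concatenated lists for its body atoms. Support comes later
  in the list because TPTL formulas look only into the future.\<close>

lemma derives_justified: "derives C t v \<Longrightarrow> \<exists>bs. justified C ((t, v) # bs)"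
proof (induction rule: derives.induct)
  case (1 t cs body v)
  have "\<forall>a\<in>set body. \<exists>bs. justified C bs \<and>
      (\<exists>v'. (fst a, v') \<in> set bs \<and> (\<forall>k<length (snd a). v' k = v (snd a ! k)))"
  proof
    fix a assume "a \<in> set body"
    with 1(3) obtain v' bs where "justified C ((fst a, v') # bs)"
      "\<forall>k<length (snd a). v' k = v (snd a ! k)"
      by blast
    then show "\<exists>bs. justified C bs \<and>
        (\<exists>v'. (fst a, v') \<in> set bs \<and> (\<forall>k<length (snd a). v' k = v (snd a ! k)))"
      by (intro exI[of _ "(fst a, v') # bs"] conjI exI[of _ v']) simp_all
  qed
  from bchoice[OF this] obtain B where B: "\<forall>a\<in>set body. justified C (B a) \<and>
      (\<exists>v'. (fst a, v') \<in> set (B a) \<and> (\<forall>k<length (snd a). v' k = v (snd a ! k)))"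
    by blast
  let ?bs = "concat (map B body)"
  have bs: "justified C ?bs"
    using B by (intro justified_concat) auto
  have body: "\<forall>a\<in>set body. \<exists>v'. (fst a, v') \<in> set ?bs \<and>
      (\<forall>k<length (snd a). v' k = v (snd a ! k))"
  proof
    fix a assume a: "a \<in> set body"
    then have "set (B a) \<subseteq> set ?bs" by auto
    with bspec[OF B a] show "\<exists>v'. (fst a, v') \<in> set ?bs \<and>
        (\<forall>k<length (snd a). v' k = v (snd a ! k))" by blast
  qed
  have "justified C ((t, v) # ?bs)"
    unfolding justified.simps
    by (intro conjI exI[of _ cs] exI[of _ body] bs body 1(1,2))
  then show ?case ..
qed

section \<open>Formulas describing derivations\<close>

text \<open>\<open>undefined\<close> is some fixed variable; the type \<open>'p\<close> is
  inhabited. One proposition suffices, since everything else is encoded in the data values.\<close>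

abbreviation mark :: "'p tptl" where
  "mark \<equiv> TProp undefined"

definition TFalse :: "'p tptl" where
  "TFalse = TAnd mark (TNot mark)"

definition TEventually :: "'p tptl \<Rightarrow> 'p tptl" where
  "TEventually \<phi> = TUntil (TNot TFalse) \<phi>"

definition TAlways :: "'p tptl \<Rightarrow> 'p tptl" where
  "TAlways \<phi> = TNot (TEventually (TNot \<phi>))"

definition TImp :: "'p tptl \<Rightarrow> 'p tptl \<Rightarrow> 'p tptl" where
  "TImp \<phi> \<psi> = TNot (TAnd \<phi> (TNot \<psi>))"

definition TConj :: "'p tptl list \<Rightarrow> 'p tptl" where
  "TConj \<phi>s = foldr TAnd \<phi>s (TNot TFalse)"

definition TDisj :: "'p tptl list \<Rightarrow> 'p tptl" where
  "TDisj \<phi>s = TNot (TConj (map TNot \<phi>s))"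

text \<open>The until is strict, so an unsatisfiable left argument forces its witness to be the very
  next position.\<close>

fun TNext :: "nat \<Rightarrow> 'p tptl \<Rightarrow> 'p tptl" where
  "TNext 0 \<phi> = \<phi>"
| "TNext (Suc k) \<phi> = TUntil TFalse (TNext k \<phi>)"

text \<open>Stores the slots of a block so that later blocks can be compared with them; register 0
  keeps the origin.\<close>

fun freeze_next :: "nat \<Rightarrow> 'p tptl \<Rightarrow> 'p tptl" where
  "freeze_next 0 \<phi> = \<phi>"
| "freeze_next (Suc m) \<phi> = freeze_next m (TNext 1 (TFreeze (Suc m) \<phi>))"

lemma sat_TFalse [simp]: "\<not> tptl_sat w i \<nu> TFalse"
  by (simp add: TFalse_def)

lemma sat_TEventually [simp]:
  "tptl_sat w i \<nu> (TEventually \<phi>) \<longleftrightarrow> (\<exists>j>i. tptl_sat w j \<nu> \<phi>)"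
  by (simp add: TEventually_def)

lemma sat_TAlways [simp]:
  "tptl_sat w i \<nu> (TAlways \<phi>) \<longleftrightarrow> (\<forall>j>i. tptl_sat w j \<nu> \<phi>)"
  by (simp add: TAlways_def)

lemma sat_TImp [simp]:
  "tptl_sat w i \<nu> (TImp \<phi> \<psi>) \<longleftrightarrow> (tptl_sat w i \<nu> \<phi> \<longrightarrow> tptl_sat w i \<nu> \<psi>)"
  by (simp add: TImp_def)

lemma sat_TConj [simp]:
  "tptl_sat w i \<nu> (TConj \<phi>s) \<longleftrightarrow> (\<forall>\<phi>\<in>set \<phi>s. tptl_sat w i \<nu> \<phi>)"
  by (induction \<phi>s) (auto simp: TConj_def)

lemma sat_TDisj [simp]:
  "tptl_sat w i \<nu> (TDisj \<phi>s) \<longleftrightarrow> (\<exists>\<phi>\<in>set \<phi>s. tptl_sat w i \<nu> \<phi>)"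
  by (simp add: TDisj_def)

lemma sat_TNext [simp]:
  "tptl_sat w i \<nu> (TNext k \<phi>) \<longleftrightarrow> tptl_sat w (i + k) \<nu> \<phi>"
proof (induction k arbitrary: i)
  case (Suc k)
  have "tptl_sat w i \<nu> (TNext (Suc k) \<phi>) \<longleftrightarrow> (\<exists>j>i. tptl_sat w (j + k) \<nu> \<phi> \<and> \<not> Suc i < j)"
    using Suc by auto
  also have "\<dots> \<longleftrightarrow> tptl_sat w (Suc i + k) \<nu> \<phi>"
    by (metis Suc_lessI lessI less_irrefl)
  finally show ?case by simp
qed simp

declare TNext.simps [simp del]

lemma sat_freeze_next [simp]:
  "tptl_sat w i \<nu> (freeze_next m \<phi>) \<longleftrightarrow>
     tptl_sat w (i + m) (\<lambda>r. if 0 < r \<and> r \<le> m then dval w (i + r) else \<nu> r) \<phi>"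
proof (induction m arbitrary: \<phi>)
  case (Suc m)
  have "(\<lambda>r. if 0 < r \<and> r \<le> m then dval w (i + r) else \<nu> r)(Suc m := dval w (Suc (i + m))) =
      (\<lambda>r. if 0 < r \<and> r \<le> Suc m then dval w (i + r) else \<nu> r)"
    by (auto simp: fun_eq_iff)
  with Suc show ?case by simp
next
  case 0
  have "(\<lambda>r. if 0 < r \<and> r \<le> 0 then dval w (i + r) else \<nu> r) = \<nu>"
    by auto
  then show ?case by simp
qed

text \<open>A block for a fact \<open>(t, v)\<close> consists of a marked position with value \<open>t\<close> and unmarked positions
  with values \<open>v 0, v 1, \<dots>\<close>, all relative to register 0. The value \<open>v l\<close> is stored in register
  \<open>Suc l\<close>.\<close>

fun constr_formula :: "constr \<Rightarrow> 'p tptl" where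
  "constr_formula (Val l I) = TNext (Suc l) (TIn 0 I)"
| "constr_formula (Diff l k I) = TNext (Suc l) (TFreeze 1 (TNext k (TIn 1 I)))"

definition atom_formula :: "nat \<times> nat list \<Rightarrow> 'p tptl" where
  "atom_formula a = TEventually (TConj (mark # TIn 0 (point (int (fst a))) #
     map (\<lambda>k. TNext (Suc k) (TIn (Suc (snd a ! k)) (point 0))) [0..<length (snd a)]))"

text \<open>Under \<open>freeze_next M\<close> the atoms are evaluated at the last slot, so
  supporting blocks start behind the present one. The constraints stand outside, where their use of
  register 1 as scratch space cannot disturb the stored slots.\<close>

definition clause_formula :: "nat \<Rightarrow> clause \<Rightarrow> 'p tptl" where
  "clause_formula M c = (case c of (t, cs, body) \<Rightarrow>
     TConj (TIn 0 (point (int t)) # freeze_next M (TConj (map atom_formula body)) #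
       map constr_formula cs))"

text \<open>Values are encoded as differences to the origin, which could be negative;
  \<open>ray 0\<close> makes every slot a natural number.\<close>

definition block_formula :: "nat \<Rightarrow> clause list \<Rightarrow> 'p tptl" where
  "block_formula M C = TAnd (TConj (map (\<lambda>l. TNext (Suc l) (TIn 0 (ray 0))) [0..<M]))
     (TDisj (map (clause_formula M) C))"

fun constr_vars :: "constr \<Rightarrow> nat list" where
  "constr_vars (Val l I) = [l]"
| "constr_vars (Diff l k I) = [l + k]"

definition clause_vars :: "clause \<Rightarrow> nat list" where
  "clause_vars c = (case c of (t, cs, body) \<Rightarrow>
     concat (map constr_vars cs) @ concat (map (\<lambda>a. length (snd a) # snd a) body))"

text \<open>A sum dominates each of its members, so every clause variable gets a slot. The added 2
  makes the bound strict and guarantees slots for the value and the input of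
  \<open>h\<close>.\<close>

definition block_size :: "clause list \<Rightarrow> nat" where
  "block_size C = sum_list (concat (map clause_vars C)) + 2"

lemma block_size_bounds:
  assumes "(t, cs, body) \<in> set C"
  shows "c \<in> set cs \<Longrightarrow> l \<in> set (constr_vars c) \<Longrightarrow> l < block_size C"
    and "a \<in> set body \<Longrightarrow> l \<in> set (snd a) \<Longrightarrow> l < block_size C"
    and "a \<in> set body \<Longrightarrow> length (snd a) < block_size C"
proof -
  have *: "l < block_size C" if "l \<in> set (clause_vars (t, cs, body))" for l
  proof -
    have "l \<in> set (concat (map clause_vars C))"
      using assms that by force
    then show ?thesis
      using member_le_sum_list by (fastforce simp: block_size_def)
  qed
  show "c \<in> set cs \<Longrightarrow> l \<in> set (constr_vars c) \<Longrightarrow> l < block_size C"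
    "a \<in> set body \<Longrightarrow> l \<in> set (snd a) \<Longrightarrow> l < block_size C"
    "a \<in> set body \<Longrightarrow> length (snd a) < block_size C"
    by (rule *; force simp: clause_vars_def)+
qed

text \<open>The last conjunct concerns the second position behind the last block; it is the one that MTL
  cannot express.\<close>

definition simulation :: "recf \<Rightarrow> 'p tptl" where
  "simulation h = (let C = clauses h 1; M = block_size C in
     TConj [
       TAlways (TImp mark (block_formula M C)),
       TNext 1 (TFreeze 1 (TEventually (TConj
         [mark, TIn 0 (point (int (eval_tag h 1))), TNext 1 (TIn 0 (point 1)),
          TNext 2 (TIn 1 (point 0))]))),
       TEventually (TConj [mark, TAlways (TNot mark), TNext (M + 2) (TIn 0 (ray 0))])])"

text \<open>Kept apart from \<open>simulation\<close> so that the input can be fixed afterwards by a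
  conjunct whose code is computable from \<open>n\<close>.\<close>

definition input_formula :: "nat \<Rightarrow> 'p tptl" where
  "input_formula n = TNext 1 (TIn 0 (point (int n)))"

section \<open>From models to derivations\<close>

lemma sat_clause_formula:
  "tptl_sat w i \<nu> (clause_formula M (t, cs, body)) \<longleftrightarrow>
     int (dval w i) - int (\<nu> 0) = int t \<and>
     (\<forall>a\<in>set body. \<exists>j>i + M. undefined \<in> props w j \<and> int (dval w j) - int (\<nu> 0) = int (fst a) \<and>
       (\<forall>k\<in>{0..<length (snd a)}. dval w (j + Suc k) =
          (if snd a ! k < M then dval w (i + Suc (snd a ! k)) else \<nu> (Suc (snd a ! k))))) \<and>
     (\<forall>c\<in>set cs. tptl_sat w i \<nu> (constr_formula c))"
  by (simp add: clause_formula_def atom_formula_def Suc_le_eq)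

text \<open>Every body atom is supported by a block at a later mark, and no mark lies behind
  \<open>e\<close>; hence the induction on the distance to \<open>e\<close>. Without a last mark,
  support could be postponed forever.\<close>

lemma derives_if_sat_block_formula:
  fixes w :: "'p data_word"
  defines "val \<equiv> \<lambda>i l. dval w (i + Suc l) - dval w 0"
  assumes \<nu>: "\<nu> 0 = dval w 0"
    and blocks: "\<And>i. 0 < i \<Longrightarrow> undefined \<in> props w i \<Longrightarrow>
      tptl_sat w i \<nu> (block_formula (block_size C) C)"
    and last: "\<And>i. e < i \<Longrightarrow> undefined \<notin> props w i"
    and i: "0 < i" "undefined \<in> props w i" "int (dval w i) - int (dval w 0) = int t"
  shows "derives C t (val i)"
  using i
proof (induction "Suc e - i" arbitrary: i t rule: less_induct)
  case less
  let ?M = "block_size C"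
  from blocks[OF less.prems(1,2)] obtain t' cs body where
    ge: "\<And>l. l < ?M \<Longrightarrow> dval w 0 \<le> dval w (i + Suc l)" and
    cl: "(t', cs, body) \<in> set C" "tptl_sat w i \<nu> (clause_formula ?M (t', cs, body))"
    by (auto simp: block_formula_def \<nu>)
  note sat = cl(2)[unfolded sat_clause_formula \<nu>]
  have t: "t' = t"
    using sat less.prems(3) by simp
  show ?case
  proof (rule derives.intros)
    show "(t, cs, body) \<in> set C"
      using cl(1) t by simp
    show "\<forall>c\<in>set cs. constr_holds (val i) c"
    proof
      fix c assume c: "c \<in> set cs"
      then have s: "tptl_sat w i \<nu> (constr_formula c)" using sat by blast
      show "constr_holds (val i) c"
      proof (cases c)
        case (Val l I)
        then have "l < ?M" using block_size_bounds(1)[OF cl(1) c] by simp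
        with s ge[of l] show ?thesis
          unfolding Val val_def by (simp add: \<nu> of_nat_diff)
      next
        case (Diff l k I)
        then have "l + k < ?M" using block_size_bounds(1)[OF cl(1) c] by simp
        with s ge[of l] ge[of "l + k"] show ?thesis
          unfolding Diff val_def by (simp add: of_nat_diff ac_simps)
      qed
    qed
    show "\<forall>a\<in>set body. \<exists>v'. derives C (fst a) v' \<and>
        (\<forall>k<length (snd a). v' k = val i (snd a ! k))"
    proof
      fix a assume a: "a \<in> set body"
      then obtain j where j: "j > i + ?M" "undefined \<in> props w j"
        "int (dval w j) - int (dval w 0) = int (fst a)"
        "\<forall>k\<in>{0..<length (snd a)}. dval w (j + Suc k) =
          (if snd a ! k < ?M then dval w (i + Suc (snd a ! k)) else \<nu> (Suc (snd a ! k)))"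
        using sat by blast
      have "j \<le> e" using last j(2) by (meson not_le)
      then have "derives C (fst a) (val j)"
        using less.hyps[of j "fst a"] j(1-3) by simp
      \<comment> \<open>The variable has a slot by the choice of \<open>block_size\<close>, which
        excludes the branch with a register outside the block.\<close>
      moreover have "val j k = val i (snd a ! k)" if "k < length (snd a)" for k
        using bspec[OF j(4), of k] block_size_bounds(2)[OF cl(1) a, of "snd a ! k"] that
        unfolding val_def by simp
      ultimately show "\<exists>v'. derives C (fst a) v' \<and> (\<forall>k<length (snd a). v' k = val i (snd a ! k))"
        by blast
    qed
  qed
qed

text \<open>The second conjunct of \<open>simulation\<close> provides the root block: value 1, and
  as argument the value at position 1, which \<open>input_formula\<close> sets to
  \<open>n\<close>.\<close>

lemma rec_eval_if_simulation:
  fixes w :: "'p data_word"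
  assumes "tptl_models w (TAnd (input_formula n) (simulation h))"
  shows "rec_eval h [n] 1"
proof -
  let ?C = "clauses h 1"
  let ?\<nu> = "\<lambda>_ :: nat. dval w 0"
  from assms obtain j e where
    n: "int (dval w 1) - int (dval w 0) = int n" and
    blocks: "\<And>i. 0 < i \<Longrightarrow> undefined \<in> props w i \<Longrightarrow>
      tptl_sat w i ?\<nu> (block_formula (block_size ?C) ?C)" and
    j: "1 < j" "undefined \<in> props w j" "int (dval w j) - int (dval w 0) = int (eval_tag h 1)"
      "int (dval w (j + 1)) - int (dval w 0) = 1" "dval w (j + 2) = dval w 1" and
    last: "\<And>i. e < i \<Longrightarrow> undefined \<notin> props w i"
    by (auto simp: tptl_models_def input_formula_def simulation_def Let_def)
  have "derives ?C (eval_tag h 1) (\<lambda>l. dval w (j + Suc l) - dval w 0)"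
    by (rule derives_if_sat_block_formula[where \<nu> = ?\<nu> and e = e])
      (use blocks last j in auto)
  then have "sound_fact (eval_tag h 1) (\<lambda>l. dval w (j + Suc l) - dval w 0)"
    by (rule derives_clauses_sound)
  moreover have "dval w (j + 1) - dval w 0 = 1" "dval w (j + 2) - dval w 0 = n"
    using j(4,5) n by linarith+
  ultimately show ?thesis
    by (simp add: sound_fact_eval)
qed

section \<open>Indistinguishability in MTL\<close>

definition interval_threshold :: "int \<Rightarrow> interval \<Rightarrow> bool" where
  "interval_threshold K I \<longleftrightarrow> (\<forall>z z'. K < z \<and> K < z' \<or> z < - K \<and> z' < - K \<longrightarrow>
     (z \<in> ints_of I \<longleftrightarrow> z' \<in> ints_of I))"

lemma interval_thresholdD:
  assumes "interval_threshold K I"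
  shows "K < z \<Longrightarrow> K < z' \<Longrightarrow> z \<in> ints_of I \<longleftrightarrow> z' \<in> ints_of I"
    and "z < - K \<Longrightarrow> z' < - K \<Longrightarrow> z \<in> ints_of I \<longleftrightarrow> z' \<in> ints_of I"
  using assms unfolding interval_threshold_def by blast+

fun mtl_threshold :: "int \<Rightarrow> 'p mtl \<Rightarrow> bool" where
  "mtl_threshold K (MProp p) \<longleftrightarrow> True"
| "mtl_threshold K (MNot \<phi>) \<longleftrightarrow> mtl_threshold K \<phi>"
| "mtl_threshold K (MAnd \<phi> \<psi>) \<longleftrightarrow> mtl_threshold K \<phi> \<and> mtl_threshold K \<psi>"
| "mtl_threshold K (MUntil \<phi> I \<psi>) \<longleftrightarrow>
     mtl_threshold K \<phi> \<and> mtl_threshold K \<psi> \<and> interval_threshold K I"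

text \<open>The absolute value of a finite endpoint serves as \<open>K\<close>. The right-hand sides
  do not mention \<open>z\<close>, so integers beyond \<open>K\<close> on the same side compare
  alike with \<open>a\<close>.\<close>

lemma endpoint_threshold:
  fixes a :: "int extended"
  shows "\<exists>K\<ge>0. \<forall>z. (K < z \<longrightarrow> (a < Fin z \<longleftrightarrow> a \<noteq> Pinf) \<and> (Fin z < a \<longleftrightarrow> a = Pinf)) \<and>
    (z < - K \<longrightarrow> (a < Fin z \<longleftrightarrow> a = Minf) \<and> (Fin z < a \<longleftrightarrow> a \<noteq> Minf))"
proof (cases a)
  case (Fin x)
  then show ?thesis by (intro exI[of _ "\<bar>x\<bar>"]) auto
qed (auto intro: exI[of _ 0])

text \<open>Asking for all larger \<open>K'\<close> too allows maxima to be taken over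
  subformulas.\<close>

lemma interval_threshold_exists: "\<exists>K\<ge>0. \<forall>K'\<ge>K. interval_threshold K' I"
proof -
  have "\<exists>a b. I \<in> {IOO a b, IOC a b, ICO a b, ICC a b}"
    by (cases I) auto
  then obtain a b where ab: "I \<in> {IOO a b, IOC a b, ICO a b, ICC a b}"
    by blast
  obtain Ka where Ka: "Ka \<ge> 0"
    "\<And>z. Ka < z \<Longrightarrow> (a < Fin z \<longleftrightarrow> a \<noteq> Pinf) \<and> (Fin z < a \<longleftrightarrow> a = Pinf)"
    "\<And>z. z < - Ka \<Longrightarrow> (a < Fin z \<longleftrightarrow> a = Minf) \<and> (Fin z < a \<longleftrightarrow> a \<noteq> Minf)"
    using endpoint_threshold[of a] by blast
  obtain Kb where Kb: "Kb \<ge> 0"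
    "\<And>z. Kb < z \<Longrightarrow> (b < Fin z \<longleftrightarrow> b \<noteq> Pinf) \<and> (Fin z < b \<longleftrightarrow> b = Pinf)"
    "\<And>z. z < - Kb \<Longrightarrow> (b < Fin z \<longleftrightarrow> b = Minf) \<and> (Fin z < b \<longleftrightarrow> b \<noteq> Minf)"
    using endpoint_threshold[of b] by blast
  have "interval_threshold K' I" if "K' \<ge> max Ka Kb" for K'
    unfolding interval_threshold_def
  proof (intro allI impI)
    fix z z' assume "K' < z \<and> K' < z' \<or> z < - K' \<and> z' < - K'"
    then have "(Ka < z \<and> Ka < z' \<and> Kb < z \<and> Kb < z') \<or>
        (z < - Ka \<and> z' < - Ka \<and> z < - Kb \<and> z' < - Kb)"
      using that by auto
    then have "(a < Fin z \<longleftrightarrow> a < Fin z') \<and> (Fin z < a \<longleftrightarrow> Fin z' < a) \<and>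
        (b < Fin z \<longleftrightarrow> b < Fin z') \<and> (Fin z < b \<longleftrightarrow> Fin z' < b)"
      using Ka(2,3) Kb(2,3) by metis
    then show "z \<in> ints_of I \<longleftrightarrow> z' \<in> ints_of I"
      using ab by (auto simp: ints_of.simps not_less[symmetric])
  qed
  then show ?thesis
    using Ka(1) by (intro exI[of _ "max Ka Kb"]) auto
qed

lemma mtl_threshold_exists: "\<exists>K\<ge>0. \<forall>K'\<ge>K. mtl_threshold K' \<phi>"
proof (induction \<phi>)
  case (MAnd \<phi> \<psi>)
  then obtain K1 K2 where "K1 \<ge> 0" "\<forall>K'\<ge>K1. mtl_threshold K' \<phi>" "\<forall>K'\<ge>K2. mtl_threshold K' \<psi>"
    by blast
  then show ?case
    by (intro exI[of _ "max K1 K2"]) auto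
next
  case (MUntil \<phi> I \<psi>)
  then obtain K1 K2 where "K1 \<ge> 0" "\<forall>K'\<ge>K1. mtl_threshold K' \<phi>" "\<forall>K'\<ge>K2. mtl_threshold K' \<psi>"
    by blast
  moreover obtain K3 where "\<forall>K'\<ge>K3. interval_threshold K' I"
    using interval_threshold_exists by blast
  ultimately show ?case
    by (intro exI[of _ "max K1 (max K2 K3)"]) auto
qed auto

definition steep_from :: "int \<Rightarrow> 'p set \<Rightarrow> nat \<Rightarrow> 'p data_word \<Rightarrow> bool" where
  "steep_from K P N w \<longleftrightarrow> (\<forall>i\<ge>N. props w i = P) \<and>
     (\<forall>i j. N \<le> i \<and> i < j \<longrightarrow> K < int (dval w j) - int (dval w i))"

text \<open>On a steep tail any witness of an until formula can be replaced by the next position: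
  its difference also exceeds \<open>K\<close>, and no position remains in between.\<close>

lemma mtl_sat_steep:
  assumes "mtl_threshold K \<phi>" "steep_from K P N w" "steep_from K P N' w'" "N \<le> i" "N' \<le> i'"
  shows "mtl_sat w i \<phi> \<longleftrightarrow> mtl_sat w' i' \<phi>"
  using assms
proof (induction \<phi> arbitrary: w w' N N' i i')
  case (MProp p)
  then show ?case by (simp add: steep_from_def)
next
  case (MNot \<phi>)
  from MNot.IH[OF _ MNot.prems(2-)] MNot.prems(1) show ?case by simp
next
  case (MAnd \<phi> \<psi>)
  from MAnd.IH(1)[OF _ MAnd.prems(2-)] MAnd.IH(2)[OF _ MAnd.prems(2-)] MAnd.prems(1)
  show ?case by simp
next
  case (MUntil \<phi> I \<psi>)
  \<comment> \<open>Stated for arbitrary words, so that exchanging them gives the converse.\<close>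
  have imp: "mtl_sat w' i' (MUntil \<phi> I \<psi>)"
    if until: "mtl_sat w i (MUntil \<phi> I \<psi>)"
      and steep: "steep_from K P N w" "steep_from K P N' w'" and i: "N \<le> i" "N' \<le> i'"
    for w w' N N' i i'
  proof -
    obtain j where j: "i < j" "mtl_sat w j \<psi>" "int (dval w j) - int (dval w i) \<in> ints_of I"
      using until by auto
    have "mtl_sat w' (Suc i') \<psi>"
      using MUntil.IH(2)[OF _ steep, of j "Suc i'"] MUntil.prems(1) i j(1,2) by simp
    moreover have "K < int (dval w j) - int (dval w i)"
      "K < int (dval w' (Suc i')) - int (dval w' i')"
      using steep i j(1) by (simp_all add: steep_from_def)
    then have "int (dval w' (Suc i')) - int (dval w' i') \<in> ints_of I"
      using MUntil.prems(1) j(3) interval_thresholdD(1) by auto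
    ultimately show ?thesis
      by (auto intro!: exI[of _ "Suc i'"])
  qed
  show ?case
    using imp[OF _ MUntil.prems(2-5)] imp[OF _ MUntil.prems(3,2,5,4)] by blast
qed

text \<open>All tail positions satisfy the same formulas, so from the prefix one can only tell whether a tail
  position lies below or above the prefix and whether another one precedes it. The first low position
  can replace the second one, because an until formula reaching it has fewer positions to check.\<close>

lemma mtl_sat_prefix:
  assumes "mtl_threshold K \<phi>"
    and pre: "\<And>i. i < N \<Longrightarrow> w i = w' i"
    and steep: "steep_from K P N w" "steep_from K P N w'"
    and low: "\<And>i. i < N \<Longrightarrow> int (dval w N) - int (dval w i) < - K"
      "\<And>i. i < N \<Longrightarrow> int (dval w' N) - int (dval w' i) < - K"
      "\<And>i. i < N \<Longrightarrow> int (dval w' (Suc N)) - int (dval w' i) < - K"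
    and high: "\<And>i j. i < N \<Longrightarrow> N < j \<Longrightarrow> K < int (dval w j) - int (dval w i)"
      "\<And>i j. i < N \<Longrightarrow> Suc N < j \<Longrightarrow> K < int (dval w' j) - int (dval w' i)"
    and "i < N"
  shows "mtl_sat w i \<phi> \<longleftrightarrow> mtl_sat w' i \<phi>"
  using assms(1) \<open>i < N\<close>
proof (induction \<phi> arbitrary: i)
  case (MProp p)
  then show ?case using pre by simp
next
  case (MUntil \<phi> I \<psi>)
  let ?int = "\<lambda>w j. int (dval w j) - int (dval w i) \<in> ints_of I"
  have th: "mtl_threshold K \<phi>" "mtl_threshold K \<psi>" "interval_threshold K I"
    using MUntil.prems(1) by auto
  note i = MUntil.prems(2)
  have tail: "mtl_sat w k \<chi> \<longleftrightarrow> mtl_sat w' k' \<chi>"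
    if "N \<le> k" "N \<le> k'" "mtl_threshold K \<chi>" for k k' \<chi>
    by (rule mtl_sat_steep[OF that(3) steep that(1,2)])
  have pre\<phi>: "mtl_sat w k \<phi> \<longleftrightarrow> mtl_sat w' k \<phi>" and pre\<psi>: "mtl_sat w k \<psi> \<longleftrightarrow> mtl_sat w' k \<psi>"
    if "k < N" for k
    using MUntil.IH th that by auto
  have lows: "?int w N \<longleftrightarrow> ?int w' N" "?int w N \<longleftrightarrow> ?int w' (Suc N)"
    by (intro interval_thresholdD(2)[OF th(3)] low[OF i])+
  have highs: "?int w j \<longleftrightarrow> ?int w' j'" if "N < j" "Suc N < j'" for j j'
    by (intro interval_thresholdD(1)[OF th(3)] high[OF i] that)
  show ?case
  proof
    assume "mtl_sat w i (MUntil \<phi> I \<psi>)"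
    then obtain j where j: "i < j" "mtl_sat w j \<psi>" "?int w j"
      "\<And>k. i < k \<Longrightarrow> k < j \<Longrightarrow> mtl_sat w k \<phi>"
      by auto
    have "\<exists>j'>i. mtl_sat w' j' \<psi> \<and> ?int w' j' \<and> (\<forall>k. i < k \<and> k < j' \<longrightarrow> mtl_sat w' k \<phi>)"
    proof (cases "j \<le> N")
      case True
      then have "mtl_sat w' j \<psi>" "?int w' j"
        using j(2,3) pre\<psi>[of j] tail[OF _ _ th(2), of j j] pre i lows(1)
        by (cases "j = N"; simp)+
      then show ?thesis
        using j(1,4) True pre\<phi> by (intro exI[of _ j]) auto
    next
      case False
      then have "N < j" by simp
      \<comment> \<open>The witness moves to the first high position of \<open>w'\<close>. The low
        positions \<open>N\<close> and \<open>Suc N\<close> before it satisfy the left argument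
        because position \<open>N\<close> of \<open>w\<close> does.\<close>
      have "mtl_sat w N \<phi>" using j(4)[of N] i \<open>N < j\<close> by simp
      then have "mtl_sat w' k \<phi>" if "i < k" "k < Suc (Suc N)" for k
        using that j(4)[of k] \<open>N < j\<close> pre\<phi>[of k] tail[OF _ _ th(1), of N k] by (cases "k < N") auto
      moreover have "mtl_sat w' (Suc (Suc N)) \<psi>"
        using tail[OF _ _ th(2), of j "Suc (Suc N)"] j(2) \<open>N < j\<close> by simp
      moreover have "?int w' (Suc (Suc N))"
        using highs[OF \<open>N < j\<close>, of "Suc (Suc N)"] j(3) by simp
      ultimately show ?thesis
        using i by (intro exI[of _ "Suc (Suc N)"]) auto
    qed
    then show "mtl_sat w' i (MUntil \<phi> I \<psi>)" by simp
  next
    assume "mtl_sat w' i (MUntil \<phi> I \<psi>)"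
    then obtain j where j: "i < j" "mtl_sat w' j \<psi>" "?int w' j"
      "\<And>k. i < k \<Longrightarrow> k < j \<Longrightarrow> mtl_sat w' k \<phi>"
      by auto
    have "\<exists>j'>i. mtl_sat w j' \<psi> \<and> ?int w j' \<and> (\<forall>k. i < k \<and> k < j' \<longrightarrow> mtl_sat w k \<phi>)"
    proof (cases "j < N")
      case True
      then show ?thesis
        using j pre\<psi>[of j] pre i pre\<phi> by (intro exI[of _ j]) auto
    next
      case False
      have pre_j: "mtl_sat w k \<phi>" if "i < k" "k < N" for k
        using that j(4)[of k] False pre\<phi>[of k] by simp
      show ?thesis
      proof (cases "j \<le> Suc N")
        case True
        \<comment> \<open>Both low positions of \<open>w'\<close> are represented by the single low
          position of \<open>w\<close>.\<close>
        then have "j = N \<or> j = Suc N" using False by auto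
        then have "?int w N" using lows j(3) by auto
        moreover have "mtl_sat w N \<psi>"
          using tail[OF _ _ th(2), of N j] j(2) False by simp
        ultimately show ?thesis
          using i pre_j by (intro exI[of _ N]) auto
      next
        case False': False
        have "mtl_sat w N \<phi>"
          using tail[OF _ _ th(1), of N N] j(4)[of N] False' i by simp
        then have "mtl_sat w k \<phi>" if "i < k" "k < Suc N" for k
          using that pre_j[of k] by (cases "k = N") auto
        moreover have "mtl_sat w (Suc N) \<psi>"
          using tail[OF _ _ th(2), of "Suc N" j] j(2) False' by simp
        moreover have "?int w (Suc N)"
          using highs[of "Suc N" j] False' j(3) by simp
        ultimately show ?thesis
          using i by (intro exI[of _ "Suc N"]) auto
      qed
    qed
    then show "mtl_sat w i (MUntil \<phi> I \<psi>)" by simp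
  qed
qed auto

section \<open>Words encoding derivations\<close>

text \<open>The prefix is shifted by \<open>b\<close>, whereas the tail values \<open>f\<close> are
  absolute and may therefore lie below the origin.\<close>

definition derivation_word ::
    "nat \<Rightarrow> nat \<Rightarrow> (nat \<times> (nat \<Rightarrow> nat)) list \<Rightarrow> nat \<Rightarrow> (nat \<Rightarrow> nat) \<Rightarrow> 'p data_word" where
  "derivation_word M n bs b f i =
    (if i = 0 then ({}, b) else if i = 1 then ({}, b + n)
     else let q = (i - 2) div Suc M; r = (i - 2) mod Suc M in
       if q < length bs then
         if r = 0 then ({undefined}, b + fst (bs ! q)) else ({}, b + snd (bs ! q) (r - 1))
       else ({}, f (i - (2 + length bs * Suc M))))"

context
  fixes M n :: nat and bs :: "(nat \<times> (nat \<Rightarrow> nat)) list"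
begin

lemma derivation_word_0: "derivation_word M n bs b f 0 = ({}, b)"
  by (simp add: derivation_word_def)

lemma derivation_word_1: "derivation_word M n bs b f (Suc 0) = ({}, b + n)"
  by (simp add: derivation_word_def)

lemma derivation_word_mark:
  assumes "q < length bs"
  shows "derivation_word M n bs b f (2 + q * Suc M) = ({undefined}, b + fst (bs ! q))"
  using assms by (simp add: derivation_word_def Let_def del: mult_Suc_right)

lemma derivation_word_slot:
  assumes "q < length bs" "l < M"
  shows "derivation_word M n bs b f (2 + q * Suc M + Suc l) = ({}, b + snd (bs ! q) l)"
proof -
  have "(q * Suc M + Suc l) div Suc M = q"
    using assms(2) by (intro div_nat_eqI) simp_all
  moreover have "(q * Suc M + Suc l) mod Suc M = Suc l"
    using assms(2) by (simp del: mult_Suc_right add_Suc_right)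
  ultimately show ?thesis
    using assms(1) by (simp add: derivation_word_def Let_def del: mult_Suc_right)
qed

lemma derivation_word_tail:
  "derivation_word M n bs b f (2 + length bs * Suc M + k) = ({}, f k)"
proof -
  have "length bs \<le> (length bs * Suc M + k) div Suc M"
    by (simp add: less_eq_div_iff_mult_less_eq del: mult_Suc_right)
  then show ?thesis
    by (simp add: derivation_word_def Let_def del: mult_Suc_right)
qed

text \<open>The tail \<open>g\<close> on the right is arbitrary: the prefix does not depend on the
  tail and depends on \<open>b\<close> only by translation.\<close>

lemma derivation_word_prefix:
  assumes "i < 2 + length bs * Suc M"
  shows "derivation_word M n bs b f i =
    (fst (derivation_word M n bs 0 g i), b + snd (derivation_word M n bs 0 g i))"
proof -
  have "(i - 2) div Suc M < length bs" if "1 < i"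
    using assms that by (intro less_mult_imp_div_less) simp
  then show ?thesis
    by (auto simp: derivation_word_def Let_def)
qed

text \<open>The bound must be independent of \<open>b\<close> and \<open>f\<close>, because these
  are chosen only after \<open>V\<close>.\<close>

lemma derivation_word_prefix_bound:
  "\<exists>V. \<forall>b f i. i < 2 + length bs * Suc M \<longrightarrow>
     b \<le> dval (derivation_word M n bs b f :: 'p data_word) i \<and>
     dval (derivation_word M n bs b f :: 'p data_word) i \<le> b + V"
proof (intro exI allI impI)
  fix b f i
  assume i: "i < 2 + length bs * Suc M"
  let ?g = "\<lambda>i. dval (derivation_word M n bs 0 id :: 'p data_word) i"
  have "?g i \<le> sum ?g {..<2 + length bs * Suc M}"
    by (rule member_le_sum) (use i in auto)
  moreover have "dval (derivation_word M n bs b f :: 'p data_word) i = b + ?g i"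
    by (subst derivation_word_prefix[OF i]) (rule snd_conv)
  ultimately show "b \<le> dval (derivation_word M n bs b f :: 'p data_word) i \<and>
      dval (derivation_word M n bs b f :: 'p data_word) i \<le> b + sum ?g {..<2 + length bs * Suc M}"
    by linarith
qed

lemma undefined_in_props_derivation_word:
  "undefined \<in> props (derivation_word M n bs b f) i \<longleftrightarrow> (\<exists>q<length bs. i = 2 + q * Suc M)"
proof
  assume "undefined \<in> props (derivation_word M n bs b f) i"
  then have "(i - 2) div Suc M < length bs \<and> (i - 2) mod Suc M = 0 \<and> 2 \<le> i"
    by (auto simp: derivation_word_def Let_def split: if_splits)
  moreover have "i - 2 = (i - 2) div Suc M * Suc M + (i - 2) mod Suc M"
    by (rule div_mult_mod_eq[symmetric])
  ultimately have "i = 2 + (i - 2) div Suc M * Suc M" "(i - 2) div Suc M < length bs"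
    by linarith+
  then show "\<exists>q<length bs. i = 2 + q * Suc M"
    by blast
next
  assume "\<exists>q<length bs. i = 2 + q * Suc M"
  then obtain q where q: "q < length bs" "i = 2 + q * Suc M" by blast
  show "undefined \<in> props (derivation_word M n bs b f) i"
    unfolding q(2) derivation_word_mark[OF q(1)] by simp
qed

end

lemma block_formula_derivation_word:
  fixes bs C b f n
  defines "M \<equiv> block_size C"
  defines "w \<equiv> derivation_word M n bs b f"
  assumes just: "justified C bs" and q: "q < length bs"
  shows "tptl_sat w (2 + q * Suc M) (\<lambda>_. b) (block_formula M C)"
proof -
  let ?i = "2 + q * Suc M"
  obtain t v where tv: "bs ! q = (t, v)" by fastforce
  have slot: "dval w (?i + Suc l) = b + v l" if "l < M" for l
    unfolding w_def derivation_word_slot[OF q that] by (simp add: tv)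
  from justified_nth[OF just q tv] obtain cs body where
    c: "(t, cs, body) \<in> set C" and cs: "\<forall>c\<in>set cs. constr_holds v c" and
    body: "\<forall>a\<in>set body. \<exists>q' v'. q < q' \<and> q' < length bs \<and> bs ! q' = (fst a, v') \<and>
         (\<forall>k<length (snd a). v' k = v (snd a ! k))"
    by blast
  have "tptl_sat w ?i (\<lambda>_. b) (clause_formula M (t, cs, body))"
    unfolding sat_clause_formula
  proof (intro conjI ballI)
    show "int (dval w ?i) - int b = int t"
      unfolding w_def derivation_word_mark[OF q] by (simp add: tv)
  next
    fix a assume a: "a \<in> set body"
    then obtain q' v' where q': "q < q'" "q' < length bs" "bs ! q' = (fst a, v')"
      and v': "\<And>k. k < length (snd a) \<Longrightarrow> v' k = v (snd a ! k)"
      using body by blast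
    let ?j = "2 + q' * Suc M"
    \<comment> \<open>A later block starts behind all slots of block \<open>q\<close>.\<close>
    have "Suc q * Suc M \<le> q' * Suc M"
      using q'(1) by (intro mult_le_mono1) simp
    then have "?i + M < ?j" by simp
    moreover have "undefined \<in> props w ?j" "int (dval w ?j) - int b = int (fst a)"
      unfolding w_def derivation_word_mark[OF q'(2)] by (simp_all add: q'(3))
    moreover have "dval w (?j + Suc k) =
        (if snd a ! k < M then dval w (?i + Suc (snd a ! k)) else b)"
      if "k \<in> {0..<length (snd a)}" for k
    proof -
      have "k < M" "snd a ! k < M"
        using that block_size_bounds(2,3)[OF c a] unfolding M_def by fastforce+
      moreover have "dval w (?j + Suc k) = b + v' k"
        unfolding w_def derivation_word_slot[OF q'(2) \<open>k < M\<close>] by (simp add: q'(3))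
      ultimately show ?thesis
        using slot v' that by simp
    qed
    ultimately show "\<exists>j>?i + M. undefined \<in> props w j \<and> int (dval w j) - int b = int (fst a) \<and>
       (\<forall>k\<in>{0..<length (snd a)}. dval w (j + Suc k) =
          (if snd a ! k < M then dval w (?i + Suc (snd a ! k)) else b))"
      by blast
  next
    fix c' assume c': "c' \<in> set cs"
    then have holds: "constr_holds v c'" using cs by blast
    show "tptl_sat w ?i (\<lambda>_. b) (constr_formula c')"
    proof (cases c')
      case (Val l I)
      then have "l < M" using block_size_bounds(1)[OF c c'] by (simp add: M_def)
      with holds slot[of l] show ?thesis by (simp add: Val)
    next
      case (Diff l k I)
      then have "l + k < M" using block_size_bounds(1)[OF c c'] by (simp add: M_def)
      with holds slot[of l] slot[of "l + k"] show ?thesis by (simp add: Diff ac_simps)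
    qed
  qed
  moreover have "tptl_sat w ?i (\<lambda>_. b) (TConj (map (\<lambda>l. TNext (Suc l) (TIn 0 (ray 0))) [0..<M]))"
    using slot by simp
  ultimately show ?thesis
    using c by (auto simp: block_formula_def simp del: sat_TConj)
qed

text \<open>All conjuncts but the last hold by construction, and the last one inspects the second
  tail value.\<close>

lemma simulation_derivation_word:
  fixes v bs n b f h
  defines "C \<equiv> clauses h 1"
  defines "M \<equiv> block_size C"
  defines "L \<equiv> (eval_tag h 1, v) # bs"
  defines "w \<equiv> derivation_word M n L b f"
  assumes just: "justified C L" and v: "v 0 = 1" "v 1 = n"
  shows "tptl_models w (TAnd (input_formula n) (simulation h)) \<longleftrightarrow> b \<le> f 1"
proof -
  let ?\<nu> = "\<lambda>_ :: nat. b"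
  let ?e = "2 + length bs * Suc M"
  have M: "2 \<le> M" by (simp add: M_def block_size_def)
  have w0: "dval w 0 = b" and w1: "dval w (Suc 0) = b + n"
    by (simp_all add: w_def derivation_word_0 derivation_word_1)
  have mark: "undefined \<in> props w i \<longleftrightarrow> (\<exists>q<length L. i = 2 + q * Suc M)" for i
    unfolding w_def by (rule undefined_in_props_derivation_word)
  have blocks: "tptl_sat w 0 ?\<nu> (TAlways (TImp mark (block_formula M C)))"
    using block_formula_derivation_word[OF just] mark unfolding w_def M_def by auto
  have "w (2 + 0 * Suc M) = ({undefined}, b + fst (L ! 0))"
    unfolding w_def by (rule derivation_word_mark) (simp add: L_def)
  moreover have "w (2 + 0 * Suc M + Suc l) = ({}, b + snd (L ! 0) l)" if "l < M" for l
    unfolding w_def by (rule derivation_word_slot) (use that in \<open>simp_all add: L_def\<close>)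
  from this[of 0] this[of 1] M
  have "w 3 = ({}, b + 1)" "w 4 = ({}, b + n)"
    by (simp_all add: L_def v[unfolded One_nat_def] numeral_eq_Suc)
  ultimately have goal: "tptl_sat w 0 ?\<nu> (TNext 1 (TFreeze 1 (TEventually (TConj
         [mark, TIn 0 (point (int (eval_tag h 1))), TNext 1 (TIn 0 (point 1)),
          TNext 2 (TIn 1 (point 0))]))))"
    using w1 by (auto simp: numeral_eq_Suc L_def intro!: exI[of _ 2])
  have last: "undefined \<in> props w i \<and> (\<forall>j>i. undefined \<notin> props w j) \<longleftrightarrow> i = ?e" for i
  proof
    assume i: "undefined \<in> props w i \<and> (\<forall>j>i. undefined \<notin> props w j)"
    then obtain q where q: "q < length L" "i = 2 + q * Suc M"
      using mark by blast
    have "undefined \<in> props w ?e"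
      unfolding mark by (intro exI[of _ "length bs"]) (simp add: L_def)
    with i have "\<not> i < ?e" by blast
    then have "length bs * Suc M \<le> q * Suc M" using q(2) by simp
    then have "length bs \<le> q" by (simp only: mult_le_cancel2)
    with q(1) have "q = length bs" by (simp add: L_def)
    with q(2) show "i = ?e" by simp
  next
    assume i: "i = ?e"
    have "undefined \<notin> props w j" if "j > ?e" for j
    proof
      assume "undefined \<in> props w j"
      then obtain q where q: "q < length L" "j = 2 + q * Suc M"
        using mark by blast
      then have "q * Suc M \<le> length bs * Suc M"
        by (intro mult_le_mono1) (simp add: L_def)
      with q(2) that show False by simp
    qed
    then show "undefined \<in> props w i \<and> (\<forall>j>i. undefined \<notin> props w j)"
      unfolding i mark by (auto simp: L_def intro!: exI[of _ "length bs"])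
  qed
  \<comment> \<open>The last mark \<open>?e\<close> is followed by \<open>M\<close> slots and then
    by the tail, whose entry number 1 is thus \<open>M + 2\<close> positions behind
    \<open>?e\<close>.\<close>
  have "2 + length L * Suc M + 1 = ?e + (M + 2)"
    by (simp add: L_def)
  moreover have "w (2 + length L * Suc M + 1) = ({}, f 1)"
    unfolding w_def by (rule derivation_word_tail)
  ultimately have "dval w (?e + (M + 2)) = f 1"
    by (metis snd_conv)
  moreover have "tptl_sat w 0 ?\<nu>
      (TEventually (TConj [mark, TAlways (TNot mark), TNext (M + 2) (TIn 0 (ray 0))])) \<longleftrightarrow>
      (\<exists>i>0. (undefined \<in> props w i \<and> (\<forall>j>i. undefined \<notin> props w j)) \<and> b \<le> dval w (i + (M + 2)))"
    by simp
  ultimately have "tptl_sat w 0 ?\<nu>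
      (TEventually (TConj [mark, TAlways (TNot mark), TNext (M + 2) (TIn 0 (ray 0))])) \<longleftrightarrow> b \<le> f 1"
    unfolding last by auto
  with blocks goal show ?thesis
    unfolding tptl_models_def w0 simulation_def C_def[symmetric] M_def[symmetric] Let_def
    by (simp add: input_formula_def w1)
qed

lemma not_mtl_definable:
  assumes "rec_eval h [n] 1"
  shows "\<nexists>\<psi> :: 'p mtl. tptl_mtl_equivalent (TAnd (input_formula n) (simulation h)) \<psi>"
proof
  assume "\<exists>\<psi> :: 'p mtl. tptl_mtl_equivalent (TAnd (input_formula n) (simulation h)) \<psi>"
  then obtain \<psi> :: "'p mtl" where
    \<psi>: "\<And>w. tptl_models w (TAnd (input_formula n) (simulation h)) \<longleftrightarrow> mtl_sat w 0 \<psi>"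
    by (auto simp: tptl_mtl_equivalent_def mtl_models_def)
  let ?C = "clauses h 1"
  have "derivable ?C (eval_tag h 1) [1, n]"
    using derivable_if_rec_eval[OF assms, of ?C] by simp
  then obtain v where "derives ?C (eval_tag h 1) v" and v: "v 0 = 1" "v 1 = n"
    by (auto simp: derivable_def less_Suc_eq)
  then obtain bs where just: "justified ?C ((eval_tag h 1, v) # bs)"
    using derives_justified by blast
  let ?L = "(eval_tag h 1, v) # bs"
  define M where "M = block_size ?C"
  define N where "N = 2 + length ?L * Suc M"
  define W :: "nat \<Rightarrow> (nat \<Rightarrow> nat) \<Rightarrow> 'p data_word" where "W = derivation_word M n ?L"
  obtain V where V: "\<And>b f i. i < N \<Longrightarrow> b \<le> dval (W b f) i \<and> dval (W b f) i \<le> b + V"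
    using derivation_word_prefix_bound[where M = M and n = n and bs = ?L and 'p = 'p]
    unfolding N_def W_def by blast
  obtain K where K: "0 \<le> K" "mtl_threshold K \<psi>"
    using mtl_threshold_exists[of \<psi>] by blast
  \<comment> \<open>The prefix values lie between \<open>b\<close> and \<open>b + V\<close>, so a
    gap of \<open>S\<close> exceeds \<open>K\<close> from each of them. The tail \<open>f\<close>
    has one value below \<open>b\<close>, namely 0, and \<open>g\<close> has two, 0 and
    \<open>S\<close>; with \<open>b = 2 * S\<close> even \<open>S\<close> is far enough below. Then
    \<open>f 1\<close> and \<open>g 1\<close> lie on different sides of \<open>b\<close>.\<close>
  define S where "S = nat K + V + 1"
  define b where "b = 2 * S"
  define f where "f = (\<lambda>k :: nat. if k = 0 then 0 else b + k * S)"
  define g where "g = (\<lambda>k. if k \<le> 1 then k * S else b + k * S)"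
  have vals: "f 0 = 0" "g 0 = 0" "g 1 = S"
    by (simp_all add: f_def g_def)
  have S: "K + int V < int S" using K(1) by (simp add: S_def)
  have tail: "W b F i = ({}, F (i - N))" if "N \<le> i" for F i
  proof -
    have "W b F (N + (i - N)) = ({}, F (i - N))"
      unfolding W_def N_def by (rule derivation_word_tail)
    with that show ?thesis by simp
  qed
  have step: "f k + S \<le> f l" "g k + S \<le> g l" if "k < l" for k l
  proof -
    have "Suc k * S \<le> l * S"
      using that by (intro mult_le_mono1) simp
    then show "f k + S \<le> f l" "g k + S \<le> g l"
      using that by (auto simp: f_def g_def)
  qed
  have steep: "steep_from K {} N (W b F)" if F: "\<And>k l. k < l \<Longrightarrow> F k + S \<le> F l" for F
    unfolding steep_from_def
  proof (intro conjI allI impI)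
    fix i j assume ij: "N \<le> i \<and> i < j"
    then have "F (i - N) + S \<le> F (j - N)" by (intro F) auto
    then show "K < int (dval (W b F) j) - int (dval (W b F) i)"
      using ij S by (simp add: tail)
  qed (simp add: tail)
  have "mtl_sat (W b f) 0 \<psi> \<longleftrightarrow> mtl_sat (W b g) 0 \<psi>"
  proof (rule mtl_sat_prefix[OF K(2) _ steep steep])
    show "0 < N" by (simp add: N_def)
    show "W b f i = W b g i" if "i < N" for i
      using that unfolding W_def N_def
      by (intro trans[OF derivation_word_prefix derivation_word_prefix[symmetric]])
    fix i assume i: "i < N"
    show "int (dval (W b f) N) - int (dval (W b f) i) < - K"
      using V[OF i, of b f] S by (simp add: tail vals) (simp add: b_def)
    show "int (dval (W b g) N) - int (dval (W b g) i) < - K"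
      using V[OF i, of b g] S by (simp add: tail vals) (simp add: b_def)
    show "int (dval (W b g) (Suc N)) - int (dval (W b g) i) < - K"
      using V[OF i, of b g] S by (simp add: tail vals(3)[simplified]) (simp add: b_def)
    fix j
    show "K < int (dval (W b f) j) - int (dval (W b f) i)" if "N < j"
    proof -
      have "b + S \<le> f (j - N)" using that by (simp add: f_def Suc_le_eq)
      then show ?thesis using V[OF i, of b f] S that by (simp add: tail)
    qed
    show "K < int (dval (W b g) j) - int (dval (W b g) i)" if "Suc N < j"
    proof -
      have "1 < j - N" using that by simp
      then have "b + S \<le> g (j - N)" by (simp add: g_def)
      then show ?thesis using V[OF i, of b g] S that by (simp add: tail)
    qed
  qed (use step in auto)
  moreover have "mtl_sat (W b F) 0 \<psi> \<longleftrightarrow> b \<le> F 1" for F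
    using simulation_derivation_word[OF just v] \<psi> unfolding W_def M_def by blast
  moreover have "b \<le> f 1" "\<not> b \<le> g 1"
    by (simp_all add: f_def g_def b_def S_def)
  ultimately show False by blast
qed

section \<open>Diagonalisation\<close>

theorem theorem3:
  shows "\<not> decidable (tptl_code :: 'p::finite tptl \<Rightarrow> nat)
           (\<lambda>\<phi>. \<exists>\<psi> :: 'p mtl. tptl_mtl_equivalent \<phi> \<psi>)"
proof
  let ?Q = "\<lambda>\<phi>. \<exists>\<psi> :: 'p mtl. tptl_mtl_equivalent \<phi> \<psi>"
  assume "decidable (tptl_code :: 'p tptl \<Rightarrow> nat) ?Q"
  then obtain f where f: "\<And>\<phi> :: 'p tptl. rec_eval f [tptl_code \<phi>] (if ?Q \<phi> then 1 else 0)"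
    by (auto simp: decidable_def)
  \<comment> \<open>The constants spell out the constructors of \<open>TAnd\<close> and of
    \<open>input_formula\<close>, unfolded to an until with left argument \<open>TFalse\<close>. The
    argument \<open>Proj 0\<close> occurs both as the input value and as the code of the second
    conjunct.\<close>
  define r where "r = rpair (rconst 3) (rpair (rpair (rconst 4)
    (rpair (rconst (tptl_code (TFalse :: 'p tptl))) (rpair (rconst 1) (rpair (rconst 0)
      (rpair (rconst 3) (rpair (Comp radd [rconst 2, Comp radd [Proj 0, Proj 0]])
        (Comp radd [rconst 2, Comp radd [Proj 0, Proj 0]]))))))) (Proj 0))"
  have r: "rec_eval r [tptl_code \<phi>] (tptl_code (TAnd (input_formula (tptl_code \<phi>)) \<phi>))"
    for \<phi> :: "'p tptl"
  proof -
    have "rec_eval (Proj 0) [m] m" for m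
      by (rule rec_eval_Proj) auto
    moreover have "rec_eval (Comp radd [rconst 2, Comp radd [Proj 0, Proj 0]]) [m]
        (endpoint_code (Fin (int m)))" for m
    proof -
      \<comment> \<open>\<open>int_encode\<close> maps a nonnegative integer to its double.\<close>
      have "endpoint_code (Fin (int m)) = 2 + (m + m)"
        by (simp add: int_encode_def sum_encode_def)
      then show ?thesis
        by (simp only:) (intro rec_eval_Comp2[OF rec_eval_rconst _ rec_eval_radd]
          rec_eval_Comp2[OF _ _ rec_eval_radd] rec_eval_Proj; simp)
    qed
    ultimately show ?thesis
      unfolding r_def input_formula_def TNext.simps One_nat_def tptl_code.simps interval_code.simps
      by (intro rec_eval_rpair rec_eval_rconst)
  qed
  define h where "h = Comp f [r]"
  define A :: "'p tptl" where "A = simulation h"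
  define n where "n = tptl_code A"
  have h: "rec_eval h [n] (if ?Q (TAnd (input_formula n) A) then 1 else 0)"
    unfolding h_def n_def by (rule rec_eval_Comp1[OF r f])
  show False
  proof (cases "?Q (TAnd (input_formula n) A)")
    case True
    with h have "rec_eval h [n] 1" by simp
    with True not_mtl_definable show False unfolding A_def by blast
  next
    case False
    with h have "rec_eval h [n] 0" by simp
    then have "\<not> rec_eval h [n] 1"
      using rec_eval_deterministic by fastforce
    then have "\<not> tptl_models w (TAnd (input_formula n) A)" for w
      using rec_eval_if_simulation unfolding A_def by blast
    \<comment> \<open>An unsatisfiable formula is MTL-definable after all, by a
      contradiction.\<close>
    then have "tptl_mtl_equivalent (TAnd (input_formula n) A)
        (MAnd (MProp undefined) (MNot (MProp undefined)))"
      by (simp add: tptl_mtl_equivalent_def mtl_models_def)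
    with False show False by blast
  qed
qed

end
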